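(* Let $\Omega\subset\mathbf{R}^n$ be a bounded open domain with the Euclidean metric, let $p\ge 1$, and let $\omega$ be a smooth $p$-form and $u$ a smooth $1$-form on $\Omega$ satisfying $$\delta\big(\rho(Q)\,\omega\big)=0,\qquad d\omega=u\wedge\omega \quad\text{on }\Omega,$$ where $Q=\langle\omega,\omega\rangle=*(\omega\wedge*\omega)$ and $\rho:\mathbf{R}^+\to\mathbf{R}^+$ is a $C^1$ function satisfying condition [U]: there are a constant $K>0$ and constants $k\ge 0$, $q\ge 0$ with $$K^{-1}(Q+k)^q\le \rho(Q)+2Q\rho'(Q)\le K(Q+k)^q\quad\text{for all }Q\ge 0.$$ Then there is a constant $C>0$ such that the scalar $Q$ satisfies on $\Omega$ the inequality $$L_\omega(Q)+C\,(Q+k)^q\big(|\nabla u|+|u|^2\big)\,Q\ \ge\ 0,$$ where $L_\omega$ is the divergence-form operator $$L_\omega(Q)=\partial_i\Big[\Big(\tfrac12\rho(Q)+Q\rho'(Q)\Big)\partial_i Q\Big]+\sigma\,\operatorname{div}\Big( *\big[\omega\wedge*\big(\rho'(Q)\,dQ\wedge\omega\big)\big]\Big)$$ for a sign $\sigma\in\{-1,+1\}$ depending only on $n$ and $p$; moreover $L_\omega$ is uniformly elliptic when $k>0$.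
   Context: $\delta:\Lambda^p\to\Lambda^{p-1}$ is the formal adjoint of the exterior derivative $d$; $*:\Lambda^p\to\Lambda^{n-p}$ is the Hodge star; $\langle\cdot,\cdot\rangle$ is the pointwise inner product on forms, so $Q=|\omega|^2$. $\partial_i=\partial/\partial x^i$ in Euclidean coordinates $x^1,\dots,x^n$, with summation over repeated indices. $|\nabla\omega|$ and $|\nabla u|$ denote the norms of the full (componentwise) Euclidean gradients. For a $1$-form $\beta=\beta_i dx^i$, $\operatorname{div}\beta=\partial_i\beta_i$; note $*[\omega\wedge*(\rho'(Q)dQ\wedge\omega)]$ is a $1$-form since $\omega\wedge*(dQ\wedge\omega)$ is an $(n-1)$-form. *)

theory Defs
  imports "HOL-Analysis.Analysis"
begin

text \<open>Euclidean space R^n is real^'n, with 'n a finite linearly ordered index type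
 (the order fixes the orientation / the basis ordering dx^1,...,dx^n).
 A (possibly inhomogeneous) differential form at a point is a coefficient function on
 index sets: alpha = Sum_I alpha(I) dx^I, where dx^I is the wedge of the dx^i, i in I,
 in increasing order. A form field is a map x |-> coefficients.\<close>

type_synonym 'n form = "'n set \<Rightarrow> real"
type_synonym 'n form_field = "real^'n \<Rightarrow> 'n form"

definition pd :: "'n::finite \<Rightarrow> (real^'n \<Rightarrow> real) \<Rightarrow> real^'n \<Rightarrow> real" where
  "pd i f x = deriv (\<lambda>t. f (x + t *\<^sub>R axis i 1)) 0"

fun Ck_on :: "nat \<Rightarrow> (real^'n::finite \<Rightarrow> real) \<Rightarrow> (real^'n) set \<Rightarrow> bool" where
  "Ck_on 0 f S = continuous_on S f"
| "Ck_on (Suc k) f S = (continuous_on S f \<and>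
     (\<forall>i. \<forall>x\<in>S. ((\<lambda>t. f (x + t *\<^sub>R axis i 1)) has_real_derivative pd i f x) (at 0)) \<and>
     (\<forall>i. Ck_on k (pd i f) S))"

definition Cinf_on :: "(real^'n::finite \<Rightarrow> real) \<Rightarrow> (real^'n) set \<Rightarrow> bool" where
  "Cinf_on f S = (\<forall>k. Ck_on k f S)"

definition smooth_form_on :: "'n::finite form_field \<Rightarrow> (real^'n) set \<Rightarrow> bool" where
  "smooth_form_on \<omega> S = (\<forall>I. Cinf_on (\<lambda>x. \<omega> x I) S)"

definition has_degree :: "'n::finite form_field \<Rightarrow> nat \<Rightarrow> bool" where
  "has_degree \<omega> p = (\<forall>x I. card I \<noteq> p \<longrightarrow> \<omega> x I = 0)"

text \<open>sign of dx^I wedge dx^J relative to dx^(I union J) for disjoint I, J\<close>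
definition sgn2 :: "'n::{finite,linorder} set \<Rightarrow> 'n set \<Rightarrow> real" where
  "sgn2 I J = (-1) ^ card {(i,j). i \<in> I \<and> j \<in> J \<and> j < i}"

definition wedge :: "'n::{finite,linorder} form \<Rightarrow> 'n form \<Rightarrow> 'n form" where
  "wedge \<alpha> \<beta> K = (\<Sum>I\<in>Pow K. sgn2 I (K - I) * \<alpha> I * \<beta> (K - I))"

definition hodge :: "'n::{finite,linorder} form \<Rightarrow> 'n form" where
  "hodge \<alpha> J = sgn2 (- J) J * \<alpha> (- J)"

definition finner :: "'n::finite form \<Rightarrow> 'n form \<Rightarrow> real" where
  "finner \<alpha> \<beta> = (\<Sum>I\<in>UNIV. \<alpha> I * \<beta> I)"

definition ext_d :: "'n::{finite,linorder} form_field \<Rightarrow> 'n form_field" where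
  "ext_d \<omega> x K = (\<Sum>j\<in>K. sgn2 {j} (K - {j}) * pd j (\<lambda>y. \<omega> y (K - {j})) x)"

text \<open>codifferential = formal L2 adjoint of ext_d in Euclidean coordinates\<close>
definition codiff :: "'n::{finite,linorder} form_field \<Rightarrow> 'n form_field" where
  "codiff \<omega> x I = - (\<Sum>j\<in>- I. sgn2 {j} I * pd j (\<lambda>y. \<omega> y (insert j I)) x)"

definition flat :: "real^('n::finite) \<Rightarrow> 'n form" where
  "flat \<xi> I = (if \<exists>i. I = {i} then \<xi> $ (THE i. I = {i}) else 0)"

definition sharp :: "('n::finite) form \<Rightarrow> real^'n" where
  "sharp \<beta> = (\<chi> i. \<beta> {i})"

definition grad :: "(real^'n::finite \<Rightarrow> real) \<Rightarrow> real^'n \<Rightarrow> real^'n" where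
  "grad f x = (\<chi> i. pd i f x)"

definition grad_norm :: "'n::finite form_field \<Rightarrow> real^'n \<Rightarrow> real" where
  "grad_norm u x = sqrt (\<Sum>i\<in>UNIV. \<Sum>I\<in>UNIV. (pd i (\<lambda>y. u y I) x)\<^sup>2)"

definition rpow :: "real \<Rightarrow> real \<Rightarrow> real" where
  "rpow b q = (if b = 0 then (if q = 0 then 1 else 0) else b powr q)"

text \<open>The flux of L_omega: L_omega(Q) = div (Vflux ... x (grad Q x)), where
 Vflux x xi = (rho(Q)/2 + Q rho'(Q)) xi + sigma * [omega wedge *(rho'(Q) xi wedge omega)]
 (xi standing for dQ).\<close>
definition Vflux :: "real \<Rightarrow> (real \<Rightarrow> real) \<Rightarrow> (real \<Rightarrow> real) \<Rightarrow> 'a::{finite,linorder} form_field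
    \<Rightarrow> (real,'a) vec \<Rightarrow> (real,'a) vec \<Rightarrow> (real,'a) vec" where
  "Vflux \<sigma> \<rho> drho \<omega> x \<xi> =
     (let Q = finner (\<omega> x) (\<omega> x) in
      (\<rho> Q / 2 + Q * drho Q) *\<^sub>R \<xi> +
      \<sigma> *\<^sub>R sharp (hodge (wedge (\<omega> x) (hodge (\<lambda>I. drho Q * wedge (flat \<xi>) (\<omega> x) I)))))"

end

theory Submission
  imports Defs
begin

text \<open>
Put \<open>F = \<rho>(Q) \<omega>\<close>, and write \<open>e\<^sub>i\<close> for \<open>dx\<^sup>i \<and> _\<close> and \<open>\<iota>\<^sub>i\<close> for its adjoint, so that
\<open>\<iota>\<^sub>i e\<^sub>j + e\<^sub>j \<iota>\<^sub>i = \<delta>\<^sub>i\<^sub>j\<close>. With \<open>\<sigma> = (-1)\<^sup>n\<close> the flux satisfies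
\<open>V(\<xi>) \<bullet> \<eta> = (\<rho>/2 + Q \<rho>') \<xi> \<bullet> \<eta> - \<rho>' \<langle>\<xi> \<and> \<omega>, \<eta> \<and> \<omega>\<rangle>\<close>, which gives ellipticity because
\<open>0 \<le> |\<xi> \<and> \<omega>|\<^sup>2 \<le> |\<xi>|\<^sup>2 Q\<close>. The equation \<open>d\<omega> = u \<and> \<omega>\<close> and the anticommutation rule turn the flux into
\<open>V(dQ)\<^sub>i = \<Sum>\<^sub>j \<langle>\<iota>\<^sub>i \<partial>\<^sub>jF, \<iota>\<^sub>j \<omega>\<rangle> + \<langle>u \<and> F, e\<^sub>i \<omega>\<rangle>\<close>. In the divergence of the first term the second
derivatives of \<open>F\<close> enter only through \<open>\<partial>\<^sub>j(\<Sum>\<^sub>i \<iota>\<^sub>i \<partial>\<^sub>iF) = 0\<close>; since \<open>F\<close> is only \<open>C\<^sup>1\<close> this is used in the form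
\<open>\<integral> \<partial>\<^sub>jf \<partial>\<^sub>i\<psi> = \<integral> \<partial>\<^sub>if \<partial>\<^sub>j\<psi>\<close> for \<open>C\<^sup>2\<close> test functions. After cancellation,
\<open>div V(dQ) = \<rho>'/2 |dQ|\<^sup>2 + \<rho> |\<nabla>\<omega>|\<^sup>2 + \<rho> \<Sum> \<partial>\<^sub>iu\<^sub>l \<langle>e\<^sub>l \<omega>, e\<^sub>i \<omega>\<rangle> + \<rho> \<Sum> u\<^sub>l \<langle>e\<^sub>l \<partial>\<^sub>i\<omega>, e\<^sub>i \<omega>\<rangle>\<close> weakly.
As \<open>|dQ|\<^sup>2 \<le> 4 Q |\<nabla>\<omega>|\<^sup>2\<close>, the first two terms are at least \<open>min {\<rho>, \<rho> + 2 Q \<rho>'} |\<nabla>\<omega>|\<^sup>2\<close>, which absorbs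
the last one, and \<open>\<rho> \<le> K (Q + k)\<^sup>q\<close> bounds the rest.
\<close>

section \<open>Wedge, contraction and Hodge star in coordinates\<close>

text \<open>In product form the sign is visibly multiplicative under disjoint unions in either
  argument, which is how the shuffle signs below are split.\<close>

lemma sgn2_alt: "sgn2 I J = (\<Prod>i\<in>I. \<Prod>j\<in>J. if j < i then -1 else 1)"
  for I J :: "'n::{finite,linorder} set"
proof -
  have eq: "{(i, j). i \<in> I \<and> j \<in> J \<and> j < i} = {z \<in> I \<times> J. snd z < fst z}"
    by auto
  have "sgn2 I J = (\<Prod>z\<in>{z \<in> I \<times> J. snd z < fst z}. -1)"
    unfolding sgn2_def eq by (rule prod_constant[symmetric])
  also have "\<dots> = (\<Prod>z\<in>I \<times> J. if snd z < fst z then -1 else 1)"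
    by (intro prod.inter_filter finite)
  also have "\<dots> = (\<Prod>i\<in>I. \<Prod>j\<in>J. if j < i then -1 else 1)"
    unfolding prod.cartesian_product case_prod_beta ..
  finally show ?thesis .
qed

lemma sgn2_Un_left: "I \<inter> I' = {} \<Longrightarrow> sgn2 (I \<union> I') J = sgn2 I J * sgn2 I' J"
  for I I' J :: "'n::{finite,linorder} set"
  by (simp add: sgn2_alt prod.union_disjoint)

lemma sgn2_Un_right: "J \<inter> J' = {} \<Longrightarrow> sgn2 I (J \<union> J') = sgn2 I J * sgn2 I J'"
  for I J J' :: "'n::{finite,linorder} set"
  by (simp add: sgn2_alt prod.union_disjoint prod.distrib)

lemma sgn2_insert_left: "i \<notin> I \<Longrightarrow> sgn2 (insert i I) J = sgn2 {i} J * sgn2 I J"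
  for I J :: "'n::{finite,linorder} set"
  using sgn2_Un_left[of "{i}" I J] by simp

lemma sgn2_insert_right: "j \<notin> J \<Longrightarrow> sgn2 I (insert j J) = sgn2 I {j} * sgn2 I J"
  for I J :: "'n::{finite,linorder} set"
  using sgn2_Un_right[of "{j}" J I] by simp

lemma sgn2_square: "sgn2 I J * sgn2 I J = 1"
  by (simp add: sgn2_def flip: power_mult_distrib)

text \<open>Each \<open>j\<close> in \<open>J\<close> lies on exactly one side of \<open>i\<close>,
  so it contributes a factor -1 to exactly one of the two signs.\<close>

lemma sgn2_swap_singleton:
  fixes i :: "'n::{finite,linorder}"
  assumes "i \<notin> J"
  shows "sgn2 {i} J * sgn2 J {i} = (-1) ^ card J"
proof -
  have "sgn2 {i} J * sgn2 J {i} = (\<Prod>j\<in>J. (if j < i then -1 else 1) * (if i < j then -1 else 1))"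
    by (simp add: sgn2_alt prod.distrib)
  also have "\<dots> = (\<Prod>j\<in>J. -1)"
  proof (rule prod.cong)
    fix j assume "j \<in> J"
    with assms have "j < i \<and> \<not> i < j \<or> \<not> j < i \<and> i < j" by (metis antisym_conv3 less_asym')
    then show "(if j < i then -1 else 1) * (if i < j then -1 else 1) = (-1::real)" by auto
  qed simp
  finally have "sgn2 {i} J * sgn2 J {i} = (\<Prod>j\<in>J. -1)" .
  then show ?thesis by simp
qed

text \<open>\<open>ewedge\<close> and \<open>contr\<close> are the operators e and \<iota> of the
  overview. They turn \<open>ext_d\<close> into \<Sum> e_j \<partial>_j and \<open>codiff\<close>
  into -\<Sum> \<iota>_j \<partial>_j (\<open>ext_d_eq\<close>, \<open>codiff_eq\<close>).\<close>

definition ewedge :: "'n::{finite,linorder} \<Rightarrow> 'n form \<Rightarrow> 'n form" where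
  "ewedge j \<alpha> K = (if j \<in> K then sgn2 {j} (K - {j}) * \<alpha> (K - {j}) else 0)"

definition contr :: "'n::{finite,linorder} \<Rightarrow> 'n form \<Rightarrow> 'n form" where
  "contr j \<alpha> I = (if j \<in> I then 0 else sgn2 {j} I * \<alpha> (insert j I))"

text \<open>Equal indices: only one of the two summands can survive, and its signs square to one.
  Distinct indices: both vanish unless \<open>j \<in> I\<close> and \<open>i \<notin> I\<close>, and
  then they differ by the factor -1 from interchanging \<open>i\<close> and
  \<open>j\<close>.\<close>

lemma contr_ewedge:
  "contr i (ewedge j \<alpha>) I + ewedge j (contr i \<alpha>) I = (if i = j then \<alpha> I else 0)"
  for i j :: "'n::{finite,linorder}"
proof (cases "i = j")
  case True
  then show ?thesis
    by (simp add: contr_def ewedge_def insert_absorb sgn2_square flip: mult.assoc)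
next
  case False
  show ?thesis
  proof (cases "i \<notin> I \<and> j \<in> I")
    case True
    define J where "J = I - {j}"
    have I: "I = insert j J" and J: "j \<notin> J" "i \<notin> J" using True by (auto simp: J_def)
    have [simp]: "insert i J - {j} = insert i J" "insert i (insert j J) - {j} = insert i J"
      using J False by auto
    have sw: "sgn2 {i} {j} * sgn2 {j} {i} = -1"
      using sgn2_swap_singleton[of i "{j}"] False by simp
    have "contr i (ewedge j \<alpha>) I + ewedge j (contr i \<alpha>) I
       = (1 + sgn2 {i} {j} * sgn2 {j} {i}) * (sgn2 {j} J * sgn2 {i} J * \<alpha> (insert i J))"
      using J False sgn2_insert_right[of j J "{i}"] sgn2_insert_right[of i J "{j}"]
      by (simp add: I contr_def ewedge_def algebra_simps)
    then show ?thesis using sw False by simp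
  qed (use False in \<open>auto simp: contr_def ewedge_def\<close>)
qed

text \<open>Removing \<open>j\<close> is a bijection from the index sets containing \<open>j\<close>
  to those avoiding it, and both operators carry the same sign along it.\<close>

lemma finner_ewedge: "finner (ewedge j \<alpha>) \<beta> = finner \<alpha> (contr j \<beta>)"
  for j :: "'n::{finite,linorder}"
proof -
  have "finner (ewedge j \<alpha>) \<beta> = (\<Sum>K\<in>{K. j \<in> K}. sgn2 {j} (K - {j}) * \<alpha> (K - {j}) * \<beta> K)"
    unfolding finner_def ewedge_def by (rule sum.mono_neutral_cong_right) auto
  also have "\<dots> = (\<Sum>I\<in>{I. j \<notin> I}. \<alpha> I * (sgn2 {j} I * \<beta> (insert j I)))"
    by (rule sum.reindex_bij_witness[where i = "insert j" and j = "\<lambda>K. K - {j}"])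
       (auto simp: insert_absorb)
  also have "\<dots> = finner \<alpha> (contr j \<beta>)"
    unfolding finner_def contr_def by (rule sum.mono_neutral_cong_left) auto
  finally show ?thesis .
qed

lemma finner_commute: "finner \<alpha> \<beta> = finner \<beta> \<alpha>"
  by (simp add: finner_def mult.commute)

lemma finner_add_left: "finner (\<lambda>I. \<alpha> I + \<beta> I) \<gamma> = finner \<alpha> \<gamma> + finner \<beta> \<gamma>"
  by (simp add: finner_def algebra_simps sum.distrib)

lemma finner_scale_left: "finner (\<lambda>I. c * \<alpha> I) \<gamma> = c * finner \<alpha> \<gamma>"
  by (simp add: finner_def algebra_simps sum_distrib_left)

lemma finner_scale_right: "finner \<gamma> (\<lambda>I. c * \<alpha> I) = c * finner \<gamma> \<alpha>"
  by (simp add: finner_def algebra_simps sum_distrib_left)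

lemma finner_sum_left: "finner (\<lambda>I. \<Sum>j\<in>A. f j I) \<gamma> = (\<Sum>j\<in>A. finner (f j) \<gamma>)"
  unfolding finner_def by (simp add: sum_distrib_right) (rule sum.swap)

lemma finner_sum_right: "finner \<gamma> (\<lambda>I. \<Sum>j\<in>A. f j I) = (\<Sum>j\<in>A. finner \<gamma> (f j))"
  unfolding finner_def by (simp add: sum_distrib_left) (rule sum.swap)

lemma finner_self_nonneg: "finner \<alpha> \<alpha> \<ge> 0"
  unfolding finner_def by (intro sum_nonneg) auto

lemma ewedge_add: "ewedge j (\<lambda>I. \<alpha> I + \<beta> I) = (\<lambda>I. ewedge j \<alpha> I + ewedge j \<beta> I)"
  by (auto simp: ewedge_def algebra_simps)

lemma ewedge_scale: "ewedge j (\<lambda>I. c * \<alpha> I) = (\<lambda>I. c * ewedge j \<alpha> I)"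
  by (auto simp: ewedge_def)

text \<open>Move \<open>contr j\<close> across as \<open>ewedge j\<close>, anticommute, and move
  \<open>contr i\<close> back. Contractions are thereby traded for wedge products, to which the
  equation for d\<omega> applies.\<close>

lemma finner_contr_contr:
  "finner (contr i \<alpha>) (contr j \<beta>) = (if i = j then finner \<alpha> \<beta> else 0) - finner (ewedge j \<alpha>) (ewedge i \<beta>)"
  for i j :: "'n::{finite,linorder}"
proof -
  have "finner (contr i \<alpha>) (contr j \<beta>) = finner (ewedge j (contr i \<alpha>)) \<beta>"
    by (simp add: finner_ewedge)
  also have "ewedge j (contr i \<alpha>) = (\<lambda>I. (if i = j then \<alpha> I else 0) + (-1) * contr i (ewedge j \<alpha>) I)"
    using contr_ewedge[of i j \<alpha>] by (auto simp: fun_eq_iff algebra_simps)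
  also have "finner \<dots> \<beta> = (if i = j then finner \<alpha> \<beta> else 0) - finner (contr i (ewedge j \<alpha>)) \<beta>"
    unfolding finner_add_left finner_scale_left by (simp add: finner_def)
  also have "finner (contr i (ewedge j \<alpha>)) \<beta> = finner (ewedge j \<alpha>) (ewedge i \<beta>)"
    by (metis finner_commute finner_ewedge)
  finally show ?thesis .
qed

section \<open>Exterior multiplication by 1-forms and norm estimates\<close>

definition vwedge :: "('n::{finite,linorder} \<Rightarrow> real) \<Rightarrow> 'n form \<Rightarrow> 'n form" where
  "vwedge v \<alpha> I = (\<Sum>j\<in>UNIV. v j * ewedge j \<alpha> I)"

lemma finner_vwedge_left: "finner (vwedge v \<alpha>) \<beta> = (\<Sum>j\<in>UNIV. v j * finner (ewedge j \<alpha>) \<beta>)"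
  unfolding vwedge_def[abs_def] by (simp add: finner_sum_left finner_scale_left)

lemma finner_vwedge_right: "finner \<beta> (vwedge v \<alpha>) = (\<Sum>j\<in>UNIV. v j * finner \<beta> (ewedge j \<alpha>))"
  by (metis (no_types, lifting) finner_commute finner_vwedge_left sum.cong)

text \<open>By \<open>finner_contr_contr\<close>, |v \<and> \<alpha>|^2 + |\<iota>_v \<alpha>|^2 =
  |v|^2 |\<alpha>|^2; the second square is dropped.\<close>

lemma vwedge_norm_le:
  "finner (vwedge v \<alpha>) (vwedge v \<alpha>) \<le> (\<Sum>i\<in>UNIV. (v i)\<^sup>2) * finner \<alpha> \<alpha>"
  for v :: "'n::{finite,linorder} \<Rightarrow> real"
proof -
  let ?\<iota> = "\<lambda>I. \<Sum>j\<in>UNIV. v j * contr j \<alpha> I"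
  have "finner ?\<iota> ?\<iota> = (\<Sum>i\<in>UNIV. \<Sum>j\<in>UNIV. v i * (v j * finner (contr i \<alpha>) (contr j \<alpha>)))"
    unfolding finner_sum_left finner_sum_right finner_scale_left finner_scale_right sum_distrib_left ..
  also have "\<dots> = (\<Sum>i\<in>UNIV. \<Sum>j\<in>UNIV. (if i = j then v i * v j * finner \<alpha> \<alpha> else 0)
       - v j * (v i * finner (ewedge j \<alpha>) (ewedge i \<alpha>)))"
    unfolding finner_contr_contr by (intro sum.cong refl) (simp add: algebra_simps)
  also have "\<dots> = (\<Sum>i\<in>UNIV. v i * v i * finner \<alpha> \<alpha>)
       - (\<Sum>i\<in>UNIV. \<Sum>j\<in>UNIV. v j * (v i * finner (ewedge j \<alpha>) (ewedge i \<alpha>)))"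
    by (simp add: sum_subtractf)
  also have "(\<Sum>i\<in>UNIV. \<Sum>j\<in>UNIV. v j * (v i * finner (ewedge j \<alpha>) (ewedge i \<alpha>)))
      = finner (vwedge v \<alpha>) (vwedge v \<alpha>)"
    unfolding finner_vwedge_left finner_vwedge_right sum_distrib_left
    by (subst sum.swap) (simp add: mult.left_commute finner_commute)
  also have "(\<Sum>i\<in>UNIV. v i * v i * finner \<alpha> \<alpha>) = (\<Sum>i\<in>UNIV. (v i)\<^sup>2) * finner \<alpha> \<alpha>"
    by (simp add: power2_eq_square sum_distrib_right)
  finally show ?thesis
    using finner_self_nonneg[of ?\<iota>] by linarith
qed

lemma finner_ewedge_self_le: "finner (ewedge j \<alpha>) (ewedge j \<alpha>) \<le> finner \<alpha> \<alpha>"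
  for j :: "'n::{finite,linorder}"
  using finner_contr_contr[of j \<alpha> j \<alpha>] finner_self_nonneg[of "contr j \<alpha>"] by simp

lemma finner_Cauchy_Schwarz: "\<bar>finner \<alpha> \<beta>\<bar> \<le> sqrt (finner \<alpha> \<alpha>) * sqrt (finner \<beta> \<beta>)"
  for \<alpha> \<beta> :: "'n::finite form"
proof -
  have "finner \<alpha> \<beta> = (\<chi> I. \<alpha> I) \<bullet> (\<chi> I. \<beta> I)" for \<alpha> \<beta> :: "'n form"
    by (simp add: finner_def inner_vec_def)
  then show ?thesis
    using Cauchy_Schwarz_ineq2[of "\<chi> I. \<alpha> I" "\<chi> I. \<beta> I"] by (simp add: norm_eq_sqrt_inner)
qed

lemma finner_ewedge_ewedge_le:
  "\<bar>finner (ewedge i \<alpha>) (ewedge j \<beta>)\<bar> \<le> sqrt (finner \<alpha> \<alpha>) * sqrt (finner \<beta> \<beta>)"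
  for i j :: "'n::{finite,linorder}"
proof -
  have "\<bar>finner (ewedge i \<alpha>) (ewedge j \<beta>)\<bar>
      \<le> sqrt (finner (ewedge i \<alpha>) (ewedge i \<alpha>)) * sqrt (finner (ewedge j \<beta>) (ewedge j \<beta>))"
    by (rule finner_Cauchy_Schwarz)
  also have "\<dots> \<le> sqrt (finner \<alpha> \<alpha>) * sqrt (finner \<beta> \<beta>)"
    by (intro mult_mono real_sqrt_le_mono finner_ewedge_self_le)
       (auto simp: finner_self_nonneg)
  finally show ?thesis .
qed

section \<open>The Hodge star expression in the flux\<close>

lemma wedge_degree_one:
  fixes \<alpha> \<beta> :: "'n::{finite,linorder} form"
  assumes "\<And>I. card I \<noteq> 1 \<Longrightarrow> \<alpha> I = 0"
  shows "wedge \<alpha> \<beta> = vwedge (\<lambda>j. \<alpha> {j}) \<beta>"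
proof
  fix K :: "'n set"
  have "wedge \<alpha> \<beta> K = (\<Sum>I\<in>(\<lambda>j. {j}) ` K. sgn2 I (K - I) * \<alpha> I * \<beta> (K - I))"
    unfolding wedge_def
    by (rule sum.mono_neutral_right) (auto intro!: assms simp: card_1_singleton_iff)
  also have "\<dots> = (\<Sum>j\<in>K. \<alpha> {j} * ewedge j \<beta> K)"
    by (subst sum.reindex) (auto simp: ewedge_def inj_on_def intro!: sum.cong)
  also have "\<dots> = vwedge (\<lambda>j. \<alpha> {j}) \<beta> K"
    unfolding vwedge_def by (rule sum.mono_neutral_left) (auto simp: ewedge_def)
  finally show "wedge \<alpha> \<beta> K = vwedge (\<lambda>j. \<alpha> {j}) \<beta> K" .
qed

lemma wedge_flat: "wedge (flat \<xi>) \<beta> = vwedge (\<lambda>j. \<xi> $ j) \<beta>"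
  for \<beta> :: "'n::{finite,linorder} form"
proof -
  have "wedge (flat \<xi>) \<beta> = vwedge (\<lambda>j. flat \<xi> {j}) \<beta>"
    by (rule wedge_degree_one) (auto simp: flat_def)
  then show ?thesis by (simp add: flat_def)
qed

text \<open>Each \<open>I\<close> avoiding \<open>i\<close> leaves a remainder \<open>R\<close> with
  \<open>- {i} = I \<union> R\<close>. Once squares of signs are removed, what is left is the cost
  of moving \<open>i\<close> past \<open>I\<close> and past \<open>R\<close>. This is (-1)^(card I +
  card R) = (-1)^(n - 1), whatever the degrees of the forms.\<close>

lemma sharp_hodge_wedge_hodge:
  fixes \<alpha> \<beta> :: "'n::{finite,linorder} form"
  shows "sharp (hodge (wedge \<alpha> (hodge \<beta>))) $ i = (-1) ^ (CARD('n) - 1) * finner (ewedge i \<alpha>) \<beta>"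
proof -
  let ?s = "(-1::real) ^ (CARD('n) - 1)"
  have "sharp (hodge (wedge \<alpha> (hodge \<beta>))) $ i
      = (\<Sum>I\<in>Pow (- {i}). sgn2 (- {i}) {i} * (sgn2 I (- {i} - I) * \<alpha> I *
          (sgn2 (- (- {i} - I)) (- {i} - I) * \<beta> (- (- {i} - I)))))"
    by (simp add: sharp_def hodge_def wedge_def sum_distrib_left)
  also have "\<dots> = (\<Sum>I\<in>Pow (- {i}). ?s * (\<alpha> I * contr i \<beta> I))"
  proof (rule sum.cong)
    fix I assume "I \<in> Pow (- {i})"
    then have i: "i \<notin> I" by auto
    define R where "R = - {i} - I"
    have iR: "i \<notin> R" and disj: "I \<inter> R = {}" and un: "- {i} = I \<union> R"
      and cR: "- R = insert i I" using i by (auto simp: R_def)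
    have card: "CARD('n) - 1 = card I + card R"
      using card_Un_disjoint[OF _ _ disj] un card_Diff_subset[of "{i}" UNIV]
      by (simp add: Compl_eq_Diff_UNIV)
    have 1: "sgn2 (- {i}) {i} = sgn2 I {i} * sgn2 R {i}"
      using un disj by (simp add: sgn2_Un_left)
    have 2: "sgn2 (insert i I) R = sgn2 {i} R * sgn2 I R"
      using i by (rule sgn2_insert_left)
    have 3: "?s = (sgn2 {i} I * sgn2 I {i}) * (sgn2 {i} R * sgn2 R {i})"
      by (simp only: sgn2_swap_singleton[OF i] sgn2_swap_singleton[OF iR] card power_add)
    have "sgn2 (- {i}) {i} * (sgn2 I R * \<alpha> I * (sgn2 (- R) R * \<beta> (- R)))
        = (sgn2 I R * sgn2 I R) * (sgn2 {i} R * sgn2 R {i} * sgn2 I {i} * (\<alpha> I * \<beta> (insert i I)))"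
      unfolding cR 1 2 by (simp add: mult_ac)
    \<comment> \<open>One square equal to 1 is exchanged for another: one copy of
      \<open>sgn2 {i} I\<close> is needed for \<open>3\<close>, the other for
      \<open>contr\<close>.\<close>
    also have "\<dots> = (sgn2 {i} I * sgn2 {i} I) * (sgn2 {i} R * sgn2 R {i} * sgn2 I {i} * (\<alpha> I * \<beta> (insert i I)))"
      by (simp only: sgn2_square)
    also have "\<dots> = ?s * (\<alpha> I * contr i \<beta> I)"
      unfolding 3 using i by (simp add: contr_def mult_ac)
    finally show "sgn2 (- {i}) {i} * (sgn2 I (- {i} - I) * \<alpha> I *
          (sgn2 (- (- {i} - I)) (- {i} - I) * \<beta> (- (- {i} - I)))) = ?s * (\<alpha> I * contr i \<beta> I)"
      unfolding R_def[symmetric] .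
  qed simp
  also have "\<dots> = (\<Sum>I\<in>UNIV. ?s * (\<alpha> I * contr i \<beta> I))"
    by (rule sum.mono_neutral_left) (auto simp: contr_def)
  also have "\<dots> = ?s * finner (ewedge i \<alpha>) \<beta>"
    unfolding finner_ewedge unfolding finner_def sum_distrib_left ..
  finally show ?thesis .
qed

text \<open>The sign (-1)^n is chosen against the factor (-1)^(n - 1) of
  \<open>sharp_hodge_wedge_hodge\<close>: their product is -1 in every dimension, the sign on which
  \<open>Vflux_elliptic\<close> rests.\<close>

lemma Vflux_inner:
  fixes \<omega> :: "'n::{finite,linorder} form_field" and \<xi> \<eta> :: "(real,'n) vec"
  shows "Vflux ((-1) ^ CARD('n)) \<rho> \<rho>' \<omega> x \<xi> \<bullet> \<eta> =
    (\<rho> (finner (\<omega> x) (\<omega> x)) / 2 + finner (\<omega> x) (\<omega> x) * \<rho>' (finner (\<omega> x) (\<omega> x))) * (\<xi> \<bullet> \<eta>)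
    - \<rho>' (finner (\<omega> x) (\<omega> x)) * finner (vwedge (($) \<xi>) (\<omega> x)) (vwedge (($) \<eta>) (\<omega> x))"
proof -
  define Q where "Q = finner (\<omega> x) (\<omega> x)"
  define G where "G = finner (vwedge (($) \<xi>) (\<omega> x)) (vwedge (($) \<eta>) (\<omega> x))"
  define s where "s = sharp (hodge (wedge (\<omega> x) (hodge (\<lambda>I. \<rho>' Q * wedge (flat \<xi>) (\<omega> x) I))))"
  have sg: "(-1::real) ^ CARD('n) * (-1) ^ (CARD('n) - 1) = -1"
    by (cases "CARD('n)") (auto simp flip: power_mult_distrib)
  have "s \<bullet> \<eta> = (\<Sum>i\<in>UNIV. ((-1) ^ (CARD('n) - 1) * \<rho>' Q)
      * (\<eta> $ i * finner (vwedge (($) \<xi>) (\<omega> x)) (ewedge i (\<omega> x))))"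
    by (simp add: s_def inner_vec_def sharp_hodge_wedge_hodge wedge_flat finner_scale_right
        finner_commute[of "vwedge _ _"] mult_ac)
  also have "\<dots> = (-1) ^ (CARD('n) - 1) * \<rho>' Q * G"
    unfolding G_def finner_vwedge_right[of _ "($) \<eta>"] by (rule sum_distrib_left[symmetric])
  finally have "(-1) ^ CARD('n) * (s \<bullet> \<eta>) = ((-1) ^ CARD('n) * (-1) ^ (CARD('n) - 1)) * (\<rho>' Q * G)"
    by (simp only: mult.assoc)
  then have "(-1) ^ CARD('n) * (s \<bullet> \<eta>) = - (\<rho>' Q * G)"
    unfolding sg by simp
  then show ?thesis
    unfolding Vflux_def Let_def Q_def[symmetric] s_def[symmetric] G_def[symmetric]
      inner_add_left inner_scaleR_left by linarith
qed

section \<open>Partial derivatives and integration by parts\<close>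

lemma pd_eqI:
  "((\<lambda>t. f (x + t *\<^sub>R axis i 1)) has_real_derivative D) (at 0) \<Longrightarrow> pd i f x = D"
  unfolding pd_def by (rule DERIV_imp_deriv)

lemma eventually_line_in:
  fixes x :: "real^'n"
  assumes "open S" "x \<in> S"
  shows "eventually (\<lambda>t. x + t *\<^sub>R axis i 1 \<in> S) (nhds (0::real))"
proof -
  have "((\<lambda>t::real. x + t *\<^sub>R axis i 1) \<longlongrightarrow> x + 0 *\<^sub>R axis i 1) (nhds 0)"
    by (intro tendsto_intros) (simp add: filterlim_ident)
  then show ?thesis
    using assms by (auto dest: topological_tendstoD)
qed

lemma Ck_on_mono:
  assumes "Ck_on k f S" "T \<subseteq> S"
  shows "Ck_on k f T"
  using assms by (induction k arbitrary: f) (auto intro: continuous_on_subset)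

lemma line_DERIV_cong:
  fixes x :: "real^'n"
  assumes "open S" "x \<in> S" "\<And>y. y \<in> S \<Longrightarrow> f y = g y"
  shows "((\<lambda>t. f (x + t *\<^sub>R axis i 1)) has_real_derivative D) (at 0)
    \<longleftrightarrow> ((\<lambda>t. g (x + t *\<^sub>R axis i 1)) has_real_derivative D) (at 0)"
  by (rule DERIV_cong_ev)
     (auto intro!: eventually_mono[OF eventually_line_in[OF assms(1,2)]] assms(3))

lemma pd_cong:
  fixes x :: "real^'n::finite"
  assumes "open S" "x \<in> S" "\<And>y. y \<in> S \<Longrightarrow> f y = g y"
  shows "pd i f x = pd i g x"
  unfolding pd_def
  by (rule deriv_cong_ev)
     (auto intro!: eventually_mono[OF eventually_line_in[OF assms(1,2)]] assms(3))

lemma pd_const [simp]: "pd i (\<lambda>_. c) x = 0"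
  by (simp add: pd_def)

lemma Ck_on_imp_continuous_on: "Ck_on k f S \<Longrightarrow> continuous_on S f"
  by (cases k) auto

lemma Ck_on_SucD: "Ck_on (Suc k) f S \<Longrightarrow> Ck_on k f S"
  by (induction k arbitrary: f) (auto simp: Ck_on_imp_continuous_on)

lemma Ck_on_pd: "Ck_on (Suc k) f S \<Longrightarrow> Ck_on k (pd i f) S"
  by simp

lemma Ck_on_DERIV:
  "Ck_on (Suc k) f S \<Longrightarrow> x \<in> S \<Longrightarrow>
    ((\<lambda>t. f (x + t *\<^sub>R axis i 1)) has_real_derivative pd i f x) (at 0)"
  by simp

text \<open>The formulas for derivatives of sums and products are known only on \<open>S\<close>,
  whereas \<open>Ck_on\<close> recurses on the functions \<open>pd i f\<close> themselves; this
  lemma bridges the two.\<close>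

lemma Ck_on_cong:
  fixes S :: "(real^'n::finite) set"
  assumes "open S" "Ck_on k f S" "\<And>y. y \<in> S \<Longrightarrow> f y = g y"
  shows "Ck_on k g S"
  using assms(2,3)
proof (induction k arbitrary: f g)
  case 0
  then show ?case by (simp cong: continuous_on_cong)
next
  case (Suc k)
  have pd: "pd i f x = pd i g x" if "x \<in> S" for i x
    using assms(1) that Suc.prems(2) by (rule pd_cong)
  moreover have "((\<lambda>t. g (x + t *\<^sub>R axis i 1)) has_real_derivative pd i f x) (at 0)"
    if "x \<in> S" for i x
    using line_DERIV_cong[OF assms(1) that, of f g] Ck_on_DERIV[OF Suc.prems(1) that] Suc.prems(2)
    by blast
  moreover have "continuous_on S g"
    using Ck_on_imp_continuous_on[OF Suc.prems(1)] Suc.prems(2) by (simp cong: continuous_on_cong)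
  moreover have "Ck_on k (pd i g) S" for i
    by (rule Suc.IH[OF Ck_on_pd[OF Suc.prems(1)]]) (rule pd)
  ultimately show ?case by simp
qed

lemma Ck_on_const [simp]: "Ck_on k (\<lambda>_. c) S"
  by (induction k arbitrary: c) (auto simp: pd_const[abs_def])

lemma Ck_on_add:
  fixes S :: "(real^'n::finite) set"
  assumes "open S" "Ck_on k f S" "Ck_on k g S"
  shows "Ck_on k (\<lambda>x. f x + g x) S"
  using assms(2,3)
proof (induction k arbitrary: f g)
  case 0
  then show ?case by (auto intro: continuous_on_add)
next
  case (Suc k)
  have D: "((\<lambda>t. f (x + t *\<^sub>R axis i 1) + g (x + t *\<^sub>R axis i 1))
      has_real_derivative pd i f x + pd i g x) (at 0)" if "x \<in> S" for i x
    by (intro DERIV_add Ck_on_DERIV[OF Suc.prems(1) that] Ck_on_DERIV[OF Suc.prems(2) that])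
  have pd: "pd i (\<lambda>x. f x + g x) x = pd i f x + pd i g x" if "x \<in> S" for i x
    using D[OF that] by (rule pd_eqI[where f = "\<lambda>x. f x + g x"])
  have "Ck_on k (\<lambda>x. pd i f x + pd i g x) S" for i
    using Suc.prems by (intro Suc.IH Ck_on_pd)
  then have "Ck_on k (pd i (\<lambda>x. f x + g x)) S" for i
    by (rule Ck_on_cong[OF assms(1)]) (simp only: pd)
  moreover have "continuous_on S (\<lambda>x. f x + g x)"
    using Suc.prems by (intro continuous_on_add Ck_on_imp_continuous_on)
  moreover have "((\<lambda>t. f (x + t *\<^sub>R axis i 1) + g (x + t *\<^sub>R axis i 1))
      has_real_derivative pd i (\<lambda>x. f x + g x) x) (at 0)" if "x \<in> S" for i x
    using D[OF that] pd[OF that] by simp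
  ultimately show ?case by simp
qed

lemma pd_mult:
  assumes "Ck_on (Suc k) f S" "Ck_on (Suc m) g S" "x \<in> S"
  shows "((\<lambda>t. f (x + t *\<^sub>R axis i 1) * g (x + t *\<^sub>R axis i 1))
      has_real_derivative pd i f x * g x + f x * pd i g x) (at 0)"
    and "pd i (\<lambda>x. f x * g x) x = pd i f x * g x + f x * pd i g x"
proof -
  show D: "((\<lambda>t. f (x + t *\<^sub>R axis i 1) * g (x + t *\<^sub>R axis i 1))
      has_real_derivative pd i f x * g x + f x * pd i g x) (at 0)"
    using DERIV_mult[OF Ck_on_DERIV[OF assms(1,3)] Ck_on_DERIV[OF assms(2,3)], of i i]
    by (simp add: add.commute mult.commute)
  show "pd i (\<lambda>x. f x * g x) x = pd i f x * g x + f x * pd i g x"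
    using D by (rule pd_eqI[where f = "\<lambda>x. f x * g x"])
qed

lemma Ck_on_mult:
  fixes S :: "(real^'n::finite) set"
  assumes "open S" "Ck_on k f S" "Ck_on k g S"
  shows "Ck_on k (\<lambda>x. f x * g x) S"
  using assms(2,3)
proof (induction k arbitrary: f g)
  case 0
  then show ?case by (auto intro: continuous_on_mult)
next
  case (Suc k)
  have "Ck_on k (\<lambda>x. pd i f x * g x + f x * pd i g x) S" for i
    using Suc.prems[THEN Ck_on_SucD] Suc.prems[THEN Ck_on_pd] by (intro Ck_on_add[OF assms(1)] Suc.IH)
  then have "Ck_on k (pd i (\<lambda>x. f x * g x)) S" for i
    by (rule Ck_on_cong[OF assms(1)]) (simp only: pd_mult(2)[OF Suc.prems])
  moreover have "continuous_on S (\<lambda>x. f x * g x)"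
    using Suc.prems by (intro continuous_on_mult Ck_on_imp_continuous_on)
  moreover have "((\<lambda>t. f (x + t *\<^sub>R axis i 1) * g (x + t *\<^sub>R axis i 1))
      has_real_derivative pd i (\<lambda>x. f x * g x) x) (at 0)" if "x \<in> S" for i x
    using pd_mult[OF Suc.prems that] by simp
  ultimately show ?case by simp
qed

lemma Ck_on_cmult:
  fixes S :: "(real^'n::finite) set"
  assumes "open S" "Ck_on k f S"
  shows "Ck_on k (\<lambda>x. c * f x) S"
  using Ck_on_mult[OF assms(1) Ck_on_const assms(2)] .

lemma pd_cmult:
  assumes "Ck_on (Suc k) f S" "x \<in> S"
  shows "pd i (\<lambda>x. c * f x) x = c * pd i f x"
  using pd_mult(2)[OF Ck_on_const[where c = c] assms] by simp

lemma Ck_on_sum: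
  fixes S :: "(real^'n::finite) set"
  assumes "open S" "\<And>a. a \<in> A \<Longrightarrow> Ck_on k (f a) S"
  shows "Ck_on k (\<lambda>x. \<Sum>a\<in>A. f a x) S"
  using assms(2) by (induction A rule: infinite_finite_induct) (auto intro: Ck_on_add[OF assms(1)])

lemma pd_sum:
  assumes "\<And>a. a \<in> A \<Longrightarrow> Ck_on (Suc k) (f a) S" "x \<in> S"
  shows "pd i (\<lambda>x. \<Sum>a\<in>A. f a x) x = (\<Sum>a\<in>A. pd i (f a) x)"
  using assms by (intro pd_eqI[where f = "\<lambda>x. \<Sum>a\<in>A. f a x"] DERIV_sum Ck_on_DERIV) auto

lemma Ck_on_Un:
  fixes S :: "(real^'n::finite) set"
  assumes "open S" "open T" "Ck_on k f S" "Ck_on k f T"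
  shows "Ck_on k f (S \<union> T)"
  using assms(3,4)
  by (induction k arbitrary: f) (auto intro: continuous_on_open_Un[OF assms(1,2)])

lemma pd_eq_0_outside:
  fixes x :: "real^'n::finite"
  assumes "closed T" "\<And>y. y \<notin> T \<Longrightarrow> f y = 0" "x \<notin> T"
  shows "pd i f x = 0"
  using pd_cong[of "- T" x f "\<lambda>_. 0" i] assms by auto

text \<open>The open sets \<open>S\<close> and \<open>- T\<close> cover the space and
  \<open>f\<close> vanishes on the second, so regularity glues. This extends products with a test
  function beyond \<Omega>.\<close>

lemma Ck_on_UNIV_of_support:
  fixes S :: "(real^'n::finite) set"
  assumes "open S" "closed T" "T \<subseteq> S" "Ck_on k f S" "\<And>y. y \<notin> T \<Longrightarrow> f y = 0"
  shows "Ck_on k f UNIV"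
proof -
  have "Ck_on k f (- T)"
    by (rule Ck_on_cong[where f = "\<lambda>_. 0"]) (use assms in auto)
  then have "Ck_on k f (S \<union> - T)"
    using assms by (intro Ck_on_Un) auto
  moreover have "S \<union> - T = UNIV" using assms(3) by auto
  ultimately show ?thesis by simp
qed

section \<open>Mean values along coordinate lines and symmetry of second derivatives\<close>

lemma line_DERIV_at:
  assumes "Ck_on (Suc k) f S" "x + t *\<^sub>R axis i 1 \<in> S"
  shows "((\<lambda>s. f (x + s *\<^sub>R axis i 1)) has_real_derivative pd i f (x + t *\<^sub>R axis i 1)) (at t)"
proof -
  have "((\<lambda>s. f (x + (s + t) *\<^sub>R axis i 1)) has_real_derivative pd i f (x + t *\<^sub>R axis i 1)) (at 0)"
    using Ck_on_DERIV[OF assms] by (simp add: algebra_simps)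
  then show ?thesis
    using DERIV_shift[of "\<lambda>s. f (x + s *\<^sub>R axis i 1)" _ 0 t] by simp
qed

lemma line_MVT:
  assumes "Ck_on (Suc k) f UNIV" "0 < s"
  obtains z where "0 < z" "z < s" "f (x + s *\<^sub>R axis i 1) - f x = s * pd i f (x + z *\<^sub>R axis i 1)"
  using MVT2[OF assms(2) line_DERIV_at[OF assms(1)], of x i] by auto

text \<open>The mean value theorem is applied twice: in direction \<open>i\<close> to the difference
  of \<open>f\<close> over a step in direction \<open>j\<close>, then in direction \<open>j\<close>
  to \<open>pd i f\<close>. Both intermediate offsets are below \<open>s\<close>, whence the
  distance bound.\<close>

lemma second_difference:
  fixes x :: "real^'n::finite"
  assumes "Ck_on 2 f UNIV" "0 < s"
  obtains y where "dist y x \<le> 2 * s"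
    "f (x + s *\<^sub>R axis i 1 + s *\<^sub>R axis j 1) - f (x + s *\<^sub>R axis i 1) - f (x + s *\<^sub>R axis j 1) + f x
      = s\<^sup>2 * pd j (pd i f) y"
proof -
  have f: "Ck_on (Suc (Suc 0)) f UNIV" using assms(1) by (simp add: numeral_2_eq_2)
  \<comment> \<open>The step in direction \<open>j\<close> stands on the left so that reassociation
    leaves a fixed base point followed by the moving offset, the shape \<open>Ck_on_DERIV\<close>
    expects.\<close>
  define g where "g y = f (s *\<^sub>R axis j 1 + y) + (- 1) * f y" for y
  have D: "((\<lambda>t. g (y + t *\<^sub>R axis i 1)) has_real_derivative pd i f (s *\<^sub>R axis j 1 + y) + (-1) * pd i f y) (at 0)" for y
    unfolding g_def add.assoc[symmetric]
    by (intro DERIV_add DERIV_cmult Ck_on_DERIV[OF f] UNIV_I)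
  have pg: "pd i g y = pd i f (s *\<^sub>R axis j 1 + y) - pd i f y" for y
    using pd_eqI[where f = g, OF D] by simp
  have "((\<lambda>t. g (x + t *\<^sub>R axis i 1)) has_real_derivative pd i g (x + t *\<^sub>R axis i 1)) (at t)" for t
  proof -
    have "((\<lambda>r. g (x + (r + t) *\<^sub>R axis i 1)) has_real_derivative pd i g (x + t *\<^sub>R axis i 1)) (at 0)"
      using D[of "x + t *\<^sub>R axis i 1"] by (simp add: algebra_simps pg)
    then show ?thesis
      using DERIV_shift[of "\<lambda>s. g (x + s *\<^sub>R axis i 1)" _ 0 t] by simp
  qed
  from MVT2[OF assms(2) this]
  obtain z where z: "0 < z" "z < s" "g (x + s *\<^sub>R axis i 1) - g x = s * pd i g (x + z *\<^sub>R axis i 1)"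
    by auto
  obtain w where w: "0 < w" "w < s" "pd i f (x + z *\<^sub>R axis i 1 + s *\<^sub>R axis j 1) - pd i f (x + z *\<^sub>R axis i 1)
     = s * pd j (pd i f) (x + z *\<^sub>R axis i 1 + w *\<^sub>R axis j 1)"
    using line_MVT[OF Ck_on_pd[OF f] assms(2)] by blast
  show thesis
  proof
    have "norm (z *\<^sub>R axis i 1 + w *\<^sub>R axis j 1 :: real^'n) \<le> norm (z *\<^sub>R axis i 1 :: real^'n) + norm (w *\<^sub>R axis j 1 :: real^'n)"
      by (rule norm_triangle_ineq)
    then show "dist (x + z *\<^sub>R axis i 1 + w *\<^sub>R axis j 1) x \<le> 2 * s"
      using z w by (simp add: dist_norm add.assoc norm_axis_1)
    show "f (x + s *\<^sub>R axis i 1 + s *\<^sub>R axis j 1) - f (x + s *\<^sub>R axis i 1) - f (x + s *\<^sub>R axis j 1) + f x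
      = s\<^sup>2 * pd j (pd i f) (x + z *\<^sub>R axis i 1 + w *\<^sub>R axis j 1)"
      using z(3) w(3) by (simp add: g_def pg power2_eq_square add_ac)
  qed
qed

text \<open>Schwarz's theorem. The second difference is symmetric in \<open>i\<close> and
  \<open>j\<close>, so the two mixed derivatives agree at suitable points within
  \<open>2 * s\<close> of \<open>x\<close>; continuity forces equality at \<open>x\<close>.\<close>

lemma pd_commute:
  fixes x :: "real^'n::finite"
  assumes "Ck_on 2 f UNIV"
  shows "pd i (pd j f) x = pd j (pd i f) x"
proof (rule ccontr)
  assume neq: "pd i (pd j f) x \<noteq> pd j (pd i f) x"
  \<comment> \<open>Half the supposed gap: two errors below \<open>e\<close> cannot add up to
    it.\<close>
  define e where "e = \<bar>pd i (pd j f) x - pd j (pd i f) x\<bar> / 2"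
  have e: "e > 0" using neq by (simp add: e_def)
  have cont: "continuous_on UNIV (pd a (pd b f))" for a b
    using assms by (simp add: numeral_2_eq_2)
  have "\<exists>d>0. \<forall>y. dist y x < d \<longrightarrow> dist (pd a (pd b f) y) (pd a (pd b f) x) < e" for a b
    using cont[of a b] e unfolding continuous_on_iff by auto
  then obtain d1 d2 where d: "d1 > 0" "d2 > 0"
      "\<And>y. dist y x < d1 \<Longrightarrow> dist (pd i (pd j f) y) (pd i (pd j f) x) < e"
      "\<And>y. dist y x < d2 \<Longrightarrow> dist (pd j (pd i f) y) (pd j (pd i f) x) < e"
    by metis
  define s where "s = min d1 d2 / 3"
  have s: "s > 0" "2 * s < d1" "2 * s < d2" using d(1,2) by (auto simp: s_def)
  obtain y where y: "dist y x \<le> 2 * s"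
    "f (x + s *\<^sub>R axis i 1 + s *\<^sub>R axis j 1) - f (x + s *\<^sub>R axis i 1) - f (x + s *\<^sub>R axis j 1) + f x
      = s\<^sup>2 * pd j (pd i f) y"
    using second_difference[OF assms s(1)] by blast
  obtain y' where y': "dist y' x \<le> 2 * s"
    "f (x + s *\<^sub>R axis j 1 + s *\<^sub>R axis i 1) - f (x + s *\<^sub>R axis j 1) - f (x + s *\<^sub>R axis i 1) + f x
      = s\<^sup>2 * pd i (pd j f) y'"
    using second_difference[OF assms s(1)] by blast
  have "s\<^sup>2 * pd j (pd i f) y = s\<^sup>2 * pd i (pd j f) y'"
    using y(2) y'(2) by (simp add: algebra_simps)
  then have "pd j (pd i f) y = pd i (pd j f) y'" using s(1) by simp
  moreover have "dist (pd i (pd j f) y') (pd i (pd j f) x) < e" "dist (pd j (pd i f) y) (pd j (pd i f) x) < e"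
    using d y(1) y'(1) s by auto
  moreover have "\<bar>pd i (pd j f) x - pd j (pd i f) x\<bar>
      \<le> \<bar>pd i (pd j f) y' - pd i (pd j f) x\<bar> + \<bar>pd i (pd j f) y' - pd j (pd i f) x\<bar>"
    by linarith
  ultimately show False
    unfolding e_def dist_real_def by simp
qed

section \<open>Integration by parts for compactly supported functions\<close>

lemma integrable_compact_support:
  fixes f :: "real^'n \<Rightarrow> real"
  assumes "continuous_on UNIV f" "compact T" "\<And>x. x \<notin> T \<Longrightarrow> f x = 0"
  shows "integrable lborel f"
proof -
  have "integrable lborel (\<lambda>x. indicator T x *\<^sub>R f x)"
    using assms by (intro borel_integrable_compact) (auto intro: continuous_on_subset)
  moreover have "(\<lambda>x. indicator T x *\<^sub>R f x) = f"
    using assms(3) by (auto simp: indicator_def fun_eq_iff)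
  ultimately show ?thesis by simp
qed

lemma lborel_translate:
  fixes f :: "real^'n \<Rightarrow> real"
  assumes "integrable lborel f"
  shows "integrable lborel (\<lambda>x. f (x + v))" "integral\<^sup>L lborel (\<lambda>x. f (x + v)) = integral\<^sup>L lborel f"
proof -
  have f: "f \<in> borel_measurable borel" using assms by auto
  have "integrable (distr lborel borel ((+) v)) f"
    using assms by (simp add: lborel_distr_plus)
  then show "integrable lborel (\<lambda>x. f (x + v))"
    by (subst (asm) integrable_distr_eq) (use f in \<open>auto simp: add.commute\<close>)
  have "integral\<^sup>L lborel f = integral\<^sup>L (distr lborel borel ((+) v)) f"
    by (simp add: lborel_distr_plus)
  also have "\<dots> = integral\<^sup>L lborel (\<lambda>x. f (x + v))"
    by (subst integral_distr) (use f in \<open>auto simp: add.commute\<close>)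
  finally show "integral\<^sup>L lborel (\<lambda>x. f (x + v)) = integral\<^sup>L lborel f" ..
qed

text \<open>Difference quotients of \<open>h\<close> have integral zero because Lebesgue measure is
  translation invariant, and dominated convergence passes this on to \<open>pd i h\<close>.\<close>

lemma integral_pd_eq_0:
  fixes h :: "real^'n::finite \<Rightarrow> real"
  assumes h: "Ck_on (Suc 0) h UNIV" and T: "compact T" "\<And>x. x \<notin> T \<Longrightarrow> h x = 0"
  shows "integrable lborel (pd i h)" "integral\<^sup>L lborel (pd i h) = 0"
proof -
  have cont: "continuous_on UNIV h" "continuous_on UNIV (pd i h)" using h by auto
  have out: "pd i h x = 0" if "x \<notin> T" for x
    using pd_eq_0_outside[OF compact_imp_closed[OF T(1)] T(2) that] by simp
  show int: "integrable lborel (pd i h)"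
    by (rule integrable_compact_support[OF cont(2) T(1) out])
  have inth: "integrable lborel h"
    by (rule integrable_compact_support[OF cont(1) T])
  obtain R where R: "\<And>x. x \<in> T \<Longrightarrow> norm x \<le> R"
    using compact_imp_bounded[OF T(1)] unfolding bounded_iff by auto
  have "compact (pd i h ` T)"
    using cont(2) T(1) by (intro compact_continuous_image) (auto intro: continuous_on_subset)
  then have "bounded (pd i h ` T)" by (rule compact_imp_bounded)
  then obtain B' where B': "\<And>x. x \<in> T \<Longrightarrow> \<bar>pd i h x\<bar> \<le> B'"
    by (auto simp: bounded_iff)
  define B where "B = \<bar>B'\<bar>"
  have B: "\<bar>pd i h x\<bar> \<le> B" for x
    using B'[of x] out[of x] by (cases "x \<in> T") (auto simp: B_def)
  define \<delta> where "\<delta> n = 1 / real (Suc n)" for n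
  have \<delta>: "\<delta> n > 0" "\<delta> n \<le> 1" for n by (auto simp: \<delta>_def)
  define s where "s n x = (h (x + \<delta> n *\<^sub>R axis i 1) - h x) / \<delta> n" for n x
  have int_s: "integral\<^sup>L lborel (s n) = 0" for n
  proof -
    have "integral\<^sup>L lborel (\<lambda>x. h (x + \<delta> n *\<^sub>R axis i 1) - h x) = 0"
      using lborel_translate[OF inth, of "\<delta> n *\<^sub>R axis i 1"] inth by simp
    then show ?thesis by (simp add: s_def[abs_def])
  qed
  have lim: "(\<lambda>n. s n x) \<longlonglongrightarrow> pd i h x" for x
  proof -
    have "((\<lambda>t. (h (x + t *\<^sub>R axis i 1) - h x) / t) \<longlongrightarrow> pd i h x) (at 0)"
      using Ck_on_DERIV[OF h, of x i] by (simp add: DERIV_def)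
    moreover have "filterlim \<delta> (at 0) sequentially"
      using LIMSEQ_inverse_real_of_nat by (auto simp: filterlim_at \<delta>_def[abs_def] inverse_eq_divide)
    ultimately show ?thesis
      unfolding s_def by (rule filterlim_compose)
  qed
  \<comment> \<open>Inside the ball the mean value theorem bounds the quotient by \<open>B\<close>.
    The steps \<open>\<delta> n\<close> are at most 1, so outside the ball of radius
    \<open>R + 1\<close> both evaluation points miss \<open>T\<close> and the quotient is
    zero.\<close>
  have bound: "norm (s n x) \<le> indicator (cball 0 (R + 1)) x *\<^sub>R B" for n x
  proof (cases "x \<in> cball 0 (R + 1)")
    case True
    obtain z where "h (x + \<delta> n *\<^sub>R axis i 1) - h x = \<delta> n * pd i h (x + z *\<^sub>R axis i 1)"
      using line_MVT[OF h \<delta>(1)] by blast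
    then have "s n x = pd i h (x + z *\<^sub>R axis i 1)" using \<delta>(1)[of n] by (simp add: s_def)
    then show ?thesis using True B by simp
  next
    case False
    have "norm (x + \<delta> n *\<^sub>R axis i 1) \<ge> norm x - norm (\<delta> n *\<^sub>R axis i 1 :: real^'n)"
      by (metis add_diff_cancel_right' diff_add_cancel norm_diff_ineq)
    also have "norm (\<delta> n *\<^sub>R axis i 1 :: real^'n) = \<delta> n"
      using \<delta>(1)[of n] by (simp add: norm_axis_1)
    finally have "norm (x + \<delta> n *\<^sub>R axis i 1) > R" "norm x > R" using False \<delta>(2)[of n] by auto
    then have "x \<notin> T" "x + \<delta> n *\<^sub>R axis i 1 \<notin> T" using R by fastforce+
    then show ?thesis using T(2) by (simp add: s_def B_def)
  qed
  have "(\<lambda>n. integral\<^sup>L lborel (s n)) \<longlonglongrightarrow> integral\<^sup>L lborel (pd i h)"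
  proof (rule integral_dominated_convergence)
    show "integrable lborel (\<lambda>x::real^'n. indicator (cball 0 (R + 1)) x *\<^sub>R B)"
      by (intro borel_integrable_compact) auto
    show "s n \<in> borel_measurable lborel" for n
      using lborel_translate(1)[OF inth, of "\<delta> n *\<^sub>R axis i 1"] inth unfolding s_def[abs_def] by simp
    show "pd i h \<in> borel_measurable lborel"
      using int by (rule borel_measurable_integrable)
    show "AE x in lborel. (\<lambda>n. s n x) \<longlonglongrightarrow> pd i h x"
      by (rule AE_I2) (rule lim)
    show "AE x in lborel. norm (s n x) \<le> indicator (cball 0 (R + 1)) x *\<^sub>R B" for n
      by (rule AE_I2) (rule bound)
  qed
  then show "integral\<^sup>L lborel (pd i h) = 0"
    by (simp add: int_s LIMSEQ_const_iff)
qed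

text \<open>The integrand is \<partial>_j(f \<partial>_i\<psi>) - \<partial>_i(f
  \<partial>_j\<psi>), since the mixed derivatives of \<open>\<psi>\<close> cancel. In this form
  \<open>f\<close> is differentiated only once.\<close>

lemma integral_pd_mult_pd_swap:
  fixes f \<psi> :: "real^'n::finite \<Rightarrow> real"
  assumes S: "open S" and f: "Ck_on (Suc 0) f S" and \<psi>: "Ck_on 2 \<psi> S"
    and T: "compact T" "T \<subseteq> S" "\<And>x. x \<notin> T \<Longrightarrow> \<psi> x = 0"
  shows "integrable lborel (\<lambda>x. pd j f x * pd i \<psi> x - pd i f x * pd j \<psi> x)"
    and "integral\<^sup>L lborel (\<lambda>x. pd j f x * pd i \<psi> x - pd i f x * pd j \<psi> x) = 0"
proof -
  have cl: "closed T" using T(1) by (rule compact_imp_closed)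
  have \<psi>U: "Ck_on 2 \<psi> UNIV" by (rule Ck_on_UNIV_of_support[OF S cl T(2) \<psi> T(3)])
  have \<psi>2: "Ck_on (Suc (Suc 0)) \<psi> S" using \<psi> by (simp add: numeral_2_eq_2)
  have p\<psi>: "Ck_on (Suc 0) (pd a \<psi>) S" "x \<notin> T \<Longrightarrow> pd a \<psi> x = 0" for a x
    using Ck_on_pd[OF \<psi>2] pd_eq_0_outside[OF cl T(3)] by auto
  have h: "Ck_on (Suc 0) (\<lambda>x. f x * pd a \<psi> x) UNIV" for a
    by (rule Ck_on_UNIV_of_support[OF S cl T(2)])
       (auto intro: Ck_on_mult[OF S f p\<psi>(1)] simp: p\<psi>(2) simp del: Ck_on.simps)
  have eq: "pd j f x * pd i \<psi> x - pd i f x * pd j \<psi> x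
    = pd j (\<lambda>x. f x * pd i \<psi> x) x - pd i (\<lambda>x. f x * pd j \<psi> x) x" for x
  proof (cases "x \<in> T")
    case True
    then have "x \<in> S" using T(2) by auto
    then show ?thesis
      unfolding pd_mult(2)[OF f p\<psi>(1) \<open>x \<in> S\<close>] pd_commute[OF \<psi>U, of i j] by simp
  next
    case False
    then show ?thesis
      using pd_eq_0_outside[OF cl, of "\<lambda>x. f x * pd _ \<psi> x"] p\<psi>(2) by simp
  qed
  have 1: "integrable lborel (pd b (\<lambda>x. f x * pd a \<psi> x))" "integral\<^sup>L lborel (pd b (\<lambda>x. f x * pd a \<psi> x)) = 0" for a b
    using integral_pd_eq_0[OF h T(1)] p\<psi>(2) by auto
  show "integrable lborel (\<lambda>x. pd j f x * pd i \<psi> x - pd i f x * pd j \<psi> x)"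
    unfolding eq by (intro Bochner_Integration.integrable_diff 1)
  show "integral\<^sup>L lborel (\<lambda>x. pd j f x * pd i \<psi> x - pd i f x * pd j \<psi> x) = 0"
    unfolding eq by (subst Bochner_Integration.integral_diff) (auto simp: 1)
qed

text \<open>A chain rule for \<open>\<rho>\<close> with only a one-sided derivative at 0: along
  every coordinate line the values of \<open>Q\<close> stay in the half-line, so the derivative
  within \<open>{0..}\<close> suffices.\<close>

lemma Ck_on_compose_halfline:
  fixes S :: "(real^'n::finite) set"
  assumes S: "open S" and Q: "Ck_on (Suc 0) Q S" "\<And>x. Q x \<ge> 0"
    and \<rho>: "\<And>s. s \<ge> 0 \<Longrightarrow> (\<rho> has_real_derivative \<rho>' s) (at s within {0..})" "continuous_on {0..} \<rho>'"
  shows "Ck_on (Suc 0) (\<lambda>x. \<rho> (Q x)) S"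
    and "x \<in> S \<Longrightarrow> pd i (\<lambda>x. \<rho> (Q x)) x = \<rho>' (Q x) * pd i Q x"
proof -
  have D: "((\<lambda>t. \<rho> (Q (x + t *\<^sub>R axis i 1))) has_real_derivative \<rho>' (Q x) * pd i Q x) (at 0)"
    if "x \<in> S" for x i
  proof -
    have "(\<rho> has_real_derivative \<rho>' (Q x)) (at (Q x) within range (\<lambda>t. Q (x + t *\<^sub>R axis i 1)))"
      by (rule has_field_derivative_subset[OF \<rho>(1)]) (use Q(2) in auto)
    with Ck_on_DERIV[OF Q(1) that, of i] show ?thesis
      using DERIV_image_chain[of \<rho> "\<rho>' (Q x)" "\<lambda>t. Q (x + t *\<^sub>R axis i 1)" 0 UNIV "pd i Q x"]
      by (simp add: o_def)
  qed
  show pd: "pd i (\<lambda>x. \<rho> (Q x)) x = \<rho>' (Q x) * pd i Q x" if "x \<in> S" for x i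
    using D[OF that] by (rule pd_eqI[where f = "\<lambda>x. \<rho> (Q x)"])
  have Qc: "continuous_on S Q" and pQ: "continuous_on S (pd i Q)" for i using Q(1) by auto
  have "continuous_on {0..} \<rho>"
    using \<rho>(1) by (intro DERIV_continuous_on) auto
  then have c1: "continuous_on S (\<lambda>x. \<rho> (Q x))"
    using Qc by (rule continuous_on_compose2) (use Q(2) in auto)
  have c2: "continuous_on S (\<lambda>x. \<rho>' (Q x))"
    by (rule continuous_on_compose2[OF \<rho>(2) Qc]) (use Q(2) in auto)
  have "continuous_on S (pd i (\<lambda>x. \<rho> (Q x)))" for i
    using continuous_on_mult[OF c2 pQ[of i]] by (rule continuous_on_eq) (simp add: pd)
  then show "Ck_on (Suc 0) (\<lambda>x. \<rho> (Q x)) S"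
    using c1 D pd by simp
qed

section \<open>The density and the curvature term\<close>

lemma rpow_nonneg: "0 \<le> rpow b q"
  by (simp add: rpow_def)

lemma rpow_pos: "0 < b \<Longrightarrow> 0 < rpow b q"
  by (simp add: rpow_def)

lemma rpow_mono: "0 \<le> a \<Longrightarrow> a \<le> b \<Longrightarrow> 0 \<le> q \<Longrightarrow> rpow a q \<le> rpow b q"
  by (auto simp: rpow_def powr_mono2)

text \<open>The exponent zero is split off because \<open>rpow 0 0 = 1\<close> while
  \<open>0 powr 0 = 0\<close>; for other exponents \<open>rpow\<close> and \<open>powr\<close> agree
  at base 0.\<close>

lemma continuous_on_rpow:
  assumes "continuous_on S f" "\<And>x. x \<in> S \<Longrightarrow> 0 \<le> f x" "0 \<le> q"
  shows "continuous_on S (\<lambda>x. rpow (f x) q)"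
proof (cases "q = 0")
  case True
  then have "rpow (f x) q = 1" for x by (simp add: rpow_def)
  then show ?thesis by simp
next
  case False
  then have "rpow (f x) q = f x powr q" for x by (simp add: rpow_def)
  then show ?thesis
    using False assms by (auto intro!: continuous_on_powr' continuous_on_const)
qed

text \<open>The quantity bounded by condition [U] is \<open>2 \<surd>t\<close> times the derivative of \<open>\<surd>t \<rho>(t)\<close>.\<close>

lemma sqrt_mult_increasing:
  fixes \<rho> \<rho>' :: "real \<Rightarrow> real"
  assumes D: "\<And>t. t \<ge> 0 \<Longrightarrow> (\<rho> has_real_derivative \<rho>' t) (at t within {0..})"
    and ab: "0 \<le> a" "a < b"
    and lo: "\<And>t. a < t \<Longrightarrow> t < b \<Longrightarrow> c \<le> d * (\<rho> t + 2 * t * \<rho>' t)"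
  shows "sqrt a * (d * \<rho> a - c) \<le> sqrt b * (d * \<rho> b - c)"
proof (rule DERIV_nonneg_imp_increasing_open[where f = "\<lambda>t. sqrt t * (d * \<rho> t - c)"])
  show "a \<le> b" using ab by simp
  have "continuous_on {0..} \<rho>" using D by (intro DERIV_continuous_on) auto
  then have "continuous_on {a..b} \<rho>" using ab by (rule_tac continuous_on_subset) auto
  then show "continuous_on {a..b} (\<lambda>t. sqrt t * (d * \<rho> t - c))"
    by (intro continuous_intros)
  fix t assume t: "a < t" "t < b"
  have "at t within {0..} = at t"
    using t ab by (intro at_within_interior) simp
  then have "(\<rho> has_real_derivative \<rho>' t) (at t)" using D[of t] t ab by simp
  define i where "i = inverse (sqrt t)"
  from \<open>(\<rho> has_real_derivative \<rho>' t) (at t)\<close>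
  have "((\<lambda>t. sqrt t * (d * \<rho> t - c)) has_real_derivative
      (i / 2) * (d * \<rho> t - c) + sqrt t * (d * \<rho>' t)) (at t)"
    unfolding i_def using t ab by (auto intro!: derivative_eq_intros)
  \<comment> \<open>This exposes \<open>i / 2\<close> as a common factor, leaving the bracket that
    \<open>lo\<close> makes nonnegative.\<close>
  moreover have "sqrt t = i * t"
    using t ab by (simp add: i_def field_simps)
  then have "(i / 2) * (d * \<rho> t - c) + sqrt t * (d * \<rho>' t) = (i / 2) * (d * (\<rho> t + 2 * t * \<rho>' t) - c)"
    by (simp only:) (simp add: algebra_simps)
  moreover have "0 \<le> (i / 2) * (d * (\<rho> t + 2 * t * \<rho>' t) - c)"
    unfolding i_def using t ab lo[OF t] by (intro mult_nonneg_nonneg) auto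
  ultimately show "\<exists>y. ((\<lambda>t. sqrt t * (d * \<rho> t - c)) has_real_derivative y) (at t) \<and> 0 \<le> y"
    by metis
qed

context
  fixes \<rho> \<rho>' :: "real \<Rightarrow> real" and K k q :: real
  assumes D: "\<And>t. t \<ge> 0 \<Longrightarrow> (\<rho> has_real_derivative \<rho>' t) (at t within {0..})"
    and K: "0 < K" and k: "0 \<le> k" and q: "0 \<le> q"
    and lower: "\<And>t. t \<ge> 0 \<Longrightarrow> rpow (t + k) q / K \<le> \<rho> t + 2 * t * \<rho>' t"
    and upper: "\<And>t. t \<ge> 0 \<Longrightarrow> \<rho> t + 2 * t * \<rho>' t \<le> K * rpow (t + k) q"
begin

text \<open>As \<open>sqrt t * \<rho> t\<close> has derivative (\<rho> + 2 t \<rho>') / (2 sqrt t),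
  the value \<rho>(s) is a weighted mean over [0, s] of the quantity in condition [U] and inherits
  its upper bound, \<open>rpow\<close> being monotone. The comparison is
  \<open>sqrt_mult_increasing\<close> with factor -1.\<close>

lemma density_le:
  assumes "0 \<le> s"
  shows "\<rho> s \<le> K * rpow (s + k) q"
proof (cases "s = 0")
  case True
  then show ?thesis using upper[of 0] by simp
next
  case False
  have "- (K * rpow (s + k) q) \<le> - 1 * (\<rho> t + 2 * t * \<rho>' t)" if "0 < t" "t < s" for t
  proof -
    have "K * rpow (t + k) q \<le> K * rpow (s + k) q"
      using that K k q by (intro mult_left_mono rpow_mono) auto
    moreover have "\<rho> t + 2 * t * \<rho>' t \<le> K * rpow (t + k) q"
      using that by (intro upper) simp
    ultimately have "\<rho> t + 2 * t * \<rho>' t \<le> K * rpow (s + k) q" by linarith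
    then show ?thesis by (metis mult_minus1 neg_le_iff_le)
  qed
  then have "sqrt 0 * (- 1 * \<rho> 0 - (- (K * rpow (s + k) q))) \<le> sqrt s * (- 1 * \<rho> s - (- (K * rpow (s + k) q)))"
    using False assms by (intro sqrt_mult_increasing[OF D]) auto
  then show ?thesis
    using False assms by (simp add: zero_le_mult_iff)
qed

text \<open>The comparison runs over [s/4, s] only, where \<open>t + k\<close> is at least
  \<open>(s + k) / 4\<close>; this costs the factor \<open>4 powr q\<close>. The left endpoint helps
  since \<rho>(s/4) \<ge> 0, and \<open>sqrt (s / 4)\<close> is half of \<open>sqrt s\<close>, which
  costs the factor 2.\<close>

lemma density_ge:
  assumes "0 \<le> s" and nonneg: "\<And>t. 0 \<le> t \<Longrightarrow> 0 \<le> \<rho> t"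
  shows "rpow (s + k) q / (2 * K * 4 powr q) \<le> \<rho> s"
proof -
  define m where "m = rpow (s / 4 + k) q / K"
  have "rpow ((s + k) / 4) q \<le> rpow (s / 4 + k) q"
    using assms k q by (intro rpow_mono) auto
  moreover have "rpow ((s + k) / 4) q = rpow (s + k) q / 4 powr q"
    using assms k by (simp add: rpow_def powr_divide)
  ultimately have "rpow (s + k) q / 4 powr q / K / 2 \<le> m / 2"
    unfolding m_def using K by (intro divide_right_mono) auto
  then have m: "rpow (s + k) q / (2 * K * 4 powr q) \<le> m / 2"
    by (simp add: ac_simps)
  have m0: "0 \<le> m" using K by (simp add: m_def rpow_nonneg)
  show ?thesis
  proof (cases "s = 0")
    case True
    then have "m \<le> \<rho> s" using lower[of 0] by (simp add: m_def)
    then show ?thesis using m m0 by linarith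
  next
    case False
    have "m \<le> 1 * (\<rho> t + 2 * t * \<rho>' t)" if "s / 4 < t" "t < s" for t
    proof -
      have "m \<le> rpow (t + k) q / K"
        unfolding m_def using that assms k q K by (intro divide_right_mono rpow_mono) auto
      then show ?thesis using lower[of t] that assms by simp
    qed
    then have "sqrt (s / 4) * (1 * \<rho> (s / 4) - m) \<le> sqrt s * (1 * \<rho> s - m)"
      using False assms by (intro sqrt_mult_increasing[OF D]) auto
    moreover have "sqrt (s / 4) * (- m) \<le> sqrt (s / 4) * (1 * \<rho> (s / 4) - m)"
      using assms nonneg[of "s / 4"] by (intro mult_left_mono) auto
    moreover have "sqrt (s / 4) = sqrt s / 2" by (simp add: real_sqrt_divide)
    ultimately have "0 \<le> sqrt s * (\<rho> s - m + m / 2)"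
      by (simp add: algebra_simps)
    then have "m / 2 \<le> \<rho> s"
      using False assms by (simp add: zero_le_mult_iff)
    then show ?thesis using m by linarith
  qed
qed

end

section \<open>Pointwise identities for the flux and the remainder\<close>

lemma sum_contr_contr:
  fixes b :: "'n::{finite,linorder} \<Rightarrow> 'n form"
  shows "(\<Sum>j\<in>UNIV. finner (contr i (b j)) (contr j \<beta>))
    = finner (b i) \<beta> - finner (\<lambda>I. \<Sum>j\<in>UNIV. ewedge j (b j) I) (ewedge i \<beta>)"
  unfolding finner_contr_contr sum_subtractf finner_sum_left by simp

text \<open>The right side of the divergence formula in the overview, with \<open>w\<close>,
  \<open>a i\<close>, \<open>v\<close>, \<open>du i l\<close>, \<open>r\<close>, \<open>r'\<close>
  for \<omega>, \<partial>_i\<omega>, u, \<partial>_i u_l, \<rho>(Q), \<rho>'(Q). Since \<partial>_i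
  Q is twice the inner product of \<omega> and \<partial>_i\<omega>, the term with
  \<open>2 * r'\<close> is (\<rho>'/2) |dQ|^2. In the context below, \<open>g\<close> stands for dQ
  and \<open>b i\<close> for \<partial>_i F.\<close>

definition curvature_term :: "'n::{finite,linorder} form \<Rightarrow> ('n \<Rightarrow> 'n form) \<Rightarrow> ('n \<Rightarrow> real)
    \<Rightarrow> ('n \<Rightarrow> 'n \<Rightarrow> real) \<Rightarrow> real \<Rightarrow> real \<Rightarrow> real" where
  "curvature_term w a v du r r' =
    (\<Sum>i\<in>UNIV. 2 * r' * (finner w (a i))\<^sup>2 + r * finner (a i) (a i))
    + r * (\<Sum>i\<in>UNIV. \<Sum>l\<in>UNIV. du i l * finner (ewedge l w) (ewedge i w))
    + r * (\<Sum>i\<in>UNIV. \<Sum>l\<in>UNIV. v l * finner (ewedge l (a i)) (ewedge i w))"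

context
  fixes w :: "'n::{finite,linorder} form" and a b :: "'n \<Rightarrow> 'n form"
    and v g :: "'n \<Rightarrow> real" and r r' :: real
  assumes closed: "\<And>I. (\<Sum>j\<in>UNIV. ewedge j (a j) I) = vwedge v w I"
    and g: "\<And>i. g i = 2 * finner w (a i)"
    and b: "\<And>i. b i = (\<lambda>I. r' * g i * w I + r * a i I)"
begin

text \<open>This is dF = \<rho>' dQ \<and> \<omega> + \<rho> u \<and> \<omega>: the product rule
  with the equation for d\<omega> inserted.\<close>

lemma sum_ewedge_b:
  "(\<Sum>j\<in>UNIV. ewedge j (b j) I) = r' * vwedge g w I + r * vwedge v w I"
proof -
  have "(\<Sum>j\<in>UNIV. ewedge j (b j) I)
      = r' * (\<Sum>j\<in>UNIV. g j * ewedge j w I) + r * (\<Sum>j\<in>UNIV. ewedge j (a j) I)"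
    unfolding b ewedge_add ewedge_scale sum.distrib sum_distrib_left by (simp add: mult.assoc)
  then show ?thesis unfolding closed vwedge_def .
qed

text \<open>By \<open>sum_contr_contr\<close> the first inner sum is \<open>finner (b i) w\<close>
  minus the pairing of dF with \<open>ewedge i w\<close>. The term with \<open>v\<close> cancels the
  u-part of dF, so only dQ remains. Later \<open>h\<close> is the gradient of the test
  function.\<close>

lemma flux_identity:
  "(\<Sum>i\<in>UNIV. h i * ((\<Sum>j\<in>UNIV. finner (contr i (b j)) (contr j w))
      + (\<Sum>l\<in>UNIV. v l * finner (ewedge l (\<lambda>I. r * w I)) (ewedge i w))))
    = (r / 2 + finner w w * r') * (\<Sum>i\<in>UNIV. g i * h i) - r' * finner (vwedge g w) (vwedge h w)"
proof -
  have summand: "(\<Sum>j\<in>UNIV. finner (contr i (b j)) (contr j w))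
      + (\<Sum>l\<in>UNIV. v l * finner (ewedge l (\<lambda>I. r * w I)) (ewedge i w))
    = (r / 2 + finner w w * r') * g i - r' * finner (vwedge g w) (ewedge i w)" for i
  proof -
    have "finner (b i) w = (r / 2 + finner w w * r') * g i"
      unfolding b finner_add_left finner_scale_left g finner_commute[of "a i" w]
      by (simp add: algebra_simps)
    moreover have "(\<Sum>l\<in>UNIV. v l * finner (ewedge l (\<lambda>I. r * w I)) (ewedge i w))
        = r * finner (vwedge v w) (ewedge i w)"
      unfolding ewedge_scale finner_scale_left finner_vwedge_left sum_distrib_left
      by (simp add: mult.left_commute)
    ultimately show ?thesis
      unfolding sum_contr_contr sum_ewedge_b finner_add_left finner_scale_left by simp
  qed
  show ?thesis
    unfolding summand finner_vwedge_right
    by (simp add: algebra_simps sum_subtractf sum_distrib_left sum.distrib)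
qed

text \<open>The left side collects the terms in which no derivative falls on the test function.
  Pairings of \<open>vwedge v w\<close> with \<open>vwedge g w\<close> and with itself enter
  negatively from the contractions (\<open>1\<close>) and positively from the term with u
  (\<open>6\<close>, \<open>7\<close>), and cancel.\<close>

lemma curvature_identity:
  "(\<Sum>i\<in>UNIV. (\<Sum>j\<in>UNIV. finner (contr i (b j)) (contr j (a i)))
      + (\<Sum>l\<in>UNIV. du i l * finner (ewedge l (\<lambda>I. r * w I)) (ewedge i w)
          + v l * (finner (ewedge l (b i)) (ewedge i w)
              + finner (ewedge l (\<lambda>I. r * w I)) (ewedge i (a i)))))
    = curvature_term w a v du r r'"
proof -
  have 1: "(\<Sum>i\<in>UNIV. \<Sum>j\<in>UNIV. finner (contr i (b j)) (contr j (a i)))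
    = (\<Sum>i\<in>UNIV. finner (b i) (a i))
      - (r' * finner (vwedge g w) (vwedge v w) + r * finner (vwedge v w) (vwedge v w))"
    unfolding sum_contr_contr sum_subtractf finner_sum_right[symmetric] closed
    unfolding sum_ewedge_b finner_add_left finner_scale_left ..
  have 2: "(\<Sum>i\<in>UNIV. finner (b i) (a i))
    = (\<Sum>i\<in>UNIV. 2 * r' * (finner w (a i))\<^sup>2 + r * finner (a i) (a i))"
    unfolding b finner_add_left finner_scale_left g
    by (simp add: power2_eq_square mult.assoc mult.left_commute)
  have 3: "(\<Sum>l\<in>UNIV. du i l * finner (ewedge l (\<lambda>I. r * w I)) (ewedge i w))
    = r * (\<Sum>l\<in>UNIV. du i l * finner (ewedge l w) (ewedge i w))" for i
    unfolding ewedge_scale finner_scale_left sum_distrib_left by (simp add: mult.left_commute)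
  have 4: "(\<Sum>l\<in>UNIV. v l * finner (ewedge l (b i)) (ewedge i w))
    = r' * (g i * finner (vwedge v w) (ewedge i w))
      + r * (\<Sum>l\<in>UNIV. v l * finner (ewedge l (a i)) (ewedge i w))" for i
    unfolding b ewedge_add ewedge_scale finner_add_left finner_scale_left finner_vwedge_left
    by (simp add: sum_distrib_left sum.distrib algebra_simps ewedge_scale finner_scale_left)
  have 5: "(\<Sum>l\<in>UNIV. v l * finner (ewedge l (\<lambda>I. r * w I)) (ewedge i (a i)))
    = r * finner (vwedge v w) (ewedge i (a i))" for i
    unfolding ewedge_scale finner_scale_left finner_vwedge_left sum_distrib_left
    by (simp add: mult.left_commute)
  have 6: "(\<Sum>i\<in>UNIV. r' * (g i * finner (vwedge v w) (ewedge i w)))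
      = r' * finner (vwedge g w) (vwedge v w)"
    unfolding sum_distrib_left[symmetric] finner_vwedge_right[symmetric]
    by (simp add: finner_commute)
  have 7: "(\<Sum>i\<in>UNIV. r * finner (vwedge v w) (ewedge i (a i))) = r * finner (vwedge v w) (vwedge v w)"
    unfolding sum_distrib_left[symmetric] finner_sum_right[symmetric] closed ..
  have 8: "(\<Sum>i\<in>UNIV. r * f i) = r * (\<Sum>i\<in>UNIV. f i)" for f :: "'n \<Rightarrow> real"
    by (rule sum_distrib_left[symmetric])
  show ?thesis
    unfolding distrib_left sum.distrib 1 2 3 4 5 6 7
    unfolding 8 curvature_term_def sum.distrib
    by simp
qed

end

text \<open>Here \<open>m\<close> plays the role of (Q + k)^q, while \<open>G\<close> and
  \<open>U\<close> bound the derivatives and squared components of u. The leading terms dominate a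
  multiple of |\<nabla>\<omega>|^2, which absorbs the term linear in \<nabla>\<omega> by completing
  a square; the rest is of order \<open>m * (G + U) * Q\<close>.\<close>

lemma curvature_term_ge:
  fixes w :: "'n::{finite,linorder} form" and a :: "'n \<Rightarrow> 'n form"
  defines "n \<equiv> real CARD('n)" and "Q \<equiv> finner w w"
  assumes r: "0 \<le> r" "r \<le> K * m" "m / K \<le> r + 2 * Q * r'" and K: "0 < K" and m: "0 \<le> m"
    and G: "\<And>i l. \<bar>du i l\<bar> \<le> G" and U: "\<And>l. (v l)\<^sup>2 \<le> U"
  shows "0 \<le> curvature_term w a v du r r' + (K * n^2 + K * n^4 + K^3 * n^4) * m * (G + U) * Q"
proof -
  define A where "A = (\<Sum>i\<in>UNIV. finner (a i) (a i))"
  define P where "P = (\<Sum>i\<in>UNIV. (finner w (a i))\<^sup>2)"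
  \<comment> \<open>\<open>z\<close> is |\<nabla>\<omega>|. The mixed sum has n^2 summands of size
    at most \<open>sqrt U * (z * sqrt Q)\<close>, so \<open>y * z\<close> bounds it.\<close>
  define z where "z = sqrt A"
  define y where "y = n^2 * (sqrt U * sqrt Q)"
  have nonneg: "0 \<le> Q" "0 \<le> A" "0 \<le> P" "0 \<le> U" "0 \<le> G"
    unfolding Q_def A_def P_def using U G
    by (auto intro!: finner_self_nonneg sum_nonneg intro: order_trans[OF zero_le_power2]
        order_trans[OF abs_ge_zero])
  have PQA: "P \<le> Q * A"
    unfolding P_def A_def sum_distrib_left
  proof (rule sum_mono)
    fix i
    have "\<bar>finner w (a i)\<bar>\<^sup>2 \<le> (sqrt Q * sqrt (finner (a i) (a i)))\<^sup>2"
      unfolding Q_def by (intro power_mono finner_Cauchy_Schwarz) simp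
    then show "(finner w (a i))\<^sup>2 \<le> Q * finner (a i) (a i)"
      using nonneg finner_self_nonneg[of "a i"] by (simp add: power_mult_distrib)
  qed
  have "\<bar>\<Sum>i\<in>UNIV. \<Sum>l\<in>UNIV. du i l * finner (ewedge l w) (ewedge i w)\<bar>
      \<le> (\<Sum>i\<in>(UNIV::'n set). \<Sum>l\<in>(UNIV::'n set). G * Q)"
    using G finner_ewedge_ewedge_le[of _ w _ w] nonneg
    by (intro order_trans[OF sum_abs] sum_mono) (auto simp: abs_mult Q_def intro!: mult_mono)
  then have B1: "\<bar>\<Sum>i\<in>UNIV. \<Sum>l\<in>UNIV. du i l * finner (ewedge l w) (ewedge i w)\<bar> \<le> n^2 * G * Q"
    by (simp add: n_def power2_eq_square mult.assoc)
  have "\<bar>\<Sum>i\<in>UNIV. \<Sum>l\<in>UNIV. v l * finner (ewedge l (a i)) (ewedge i w)\<bar>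
      \<le> (\<Sum>i\<in>(UNIV::'n set). \<Sum>l\<in>(UNIV::'n set). sqrt U * (z * sqrt Q))"
  proof (intro order_trans[OF sum_abs] sum_mono)
    fix i l
    have "finner (a i) (a i) \<le> A"
      unfolding A_def by (rule member_le_sum) (auto simp: finner_self_nonneg)
    then have "\<bar>finner (ewedge l (a i)) (ewedge i w)\<bar> \<le> z * sqrt Q"
      unfolding z_def Q_def
      by (intro order_trans[OF finner_ewedge_ewedge_le] mult_right_mono)
         (auto simp: finner_self_nonneg)
    moreover have "\<bar>v l\<bar> \<le> sqrt U"
      using U[of l] by (metis real_sqrt_abs real_sqrt_le_iff)
    ultimately show "\<bar>v l * finner (ewedge l (a i)) (ewedge i w)\<bar> \<le> sqrt U * (z * sqrt Q)"
      unfolding abs_mult using nonneg by (intro mult_mono) auto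
  qed
  then have B2: "\<bar>\<Sum>i\<in>UNIV. \<Sum>l\<in>UNIV. v l * finner (ewedge l (a i)) (ewedge i w)\<bar> \<le> y * z"
    by (simp add: n_def y_def power2_eq_square mult_ac)
  have lead: "(\<Sum>i\<in>UNIV. 2 * r' * (finner w (a i))\<^sup>2 + r * finner (a i) (a i)) = 2 * r' * P + r * A"
    unfolding P_def A_def sum.distrib sum_distrib_left ..
  have Az: "A = z^2" using nonneg by (simp add: z_def)
  have y2: "y^2 = n^4 * U * Q"
    using nonneg by (simp add: y_def power_mult_distrib flip: power_mult)
  \<comment> \<open>The summand \<open>K\<close> in the constant serves the case
    \<open>0 \<le> r'\<close>, where \<open>r\<close> alone does the absorbing, and
    \<open>K^3\<close> serves the other case.\<close>
  have main: "0 \<le> 2 * r' * P + r * A - r * (y * z) + (K + K^3) * m * y^2"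
  proof (cases "0 \<le> r'")
    case True
    have "0 \<le> r * (z - y / 2)\<^sup>2" using r by simp
    then have "0 \<le> r * A - r * (y * z) + r * y^2"
      unfolding Az using r by (simp add: power2_eq_square algebra_simps)
        (use mult_nonneg_nonneg[OF r(1) zero_le_square[of y]] in linarith)
    moreover have "r * y^2 \<le> K * m * y^2"
      using r by (intro mult_right_mono) auto
    moreover have "0 \<le> 2 * r' * P" "0 \<le> K^3 * m * y^2"
      using True nonneg K m by auto
    ultimately show ?thesis by (simp add: algebra_simps)
  next
    case False
    \<comment> \<open>With \<open>r'\<close> negative, Cauchy-Schwarz in the form
      \<open>P \<le> Q * A\<close> reduces the leading terms to \<open>(r + 2 * Q * r') * A\<close>,
      where the lower bound of [U] applies.\<close>
    have "2 * r' * (Q * A) \<le> 2 * r' * P"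
      using PQA False by (intro mult_left_mono_neg) auto
    moreover have "m / K * A \<le> (r + 2 * Q * r') * A"
      using r nonneg by (intro mult_right_mono) auto
    moreover have "r * (y * z) \<le> K * m * (y * z)"
      using r nonneg by (intro mult_right_mono) (auto simp: y_def z_def)
    \<comment> \<open>The centre \<open>K^2 * y / 2\<close> makes the cross term exactly
      \<open>K * m * (y * z)\<close>, the bound for \<open>r * (y * z)\<close>.\<close>
    moreover have "0 \<le> m / K * (z - K^2 * y / 2)\<^sup>2" using m K by simp
    then have "0 \<le> m / K * A - K * m * (y * z) + K^3 * m * y^2 / 4"
      unfolding Az using K by (simp add: power2_eq_square power3_eq_cube field_simps)
    moreover have "0 \<le> K^3 * m * y^2" "0 \<le> K * m * y^2"
      using nonneg K m by auto
    ultimately show ?thesis by (simp add: algebra_simps)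
  qed
  have "r * (n^2 * G * Q) \<le> K * m * (n^2 * G * Q)"
    using r nonneg by (intro mult_right_mono) (auto simp: n_def)
  moreover have "r * \<bar>\<Sum>i\<in>UNIV. \<Sum>l\<in>UNIV. du i l * finner (ewedge l w) (ewedge i w)\<bar> \<le> r * (n^2 * G * Q)"
    "r * \<bar>\<Sum>i\<in>UNIV. \<Sum>l\<in>UNIV. v l * finner (ewedge l (a i)) (ewedge i w)\<bar> \<le> r * (y * z)"
    using B1 B2 r by (auto intro: mult_left_mono)
  moreover have "- (r * \<bar>x\<bar>) \<le> r * x" for x
    using r by (metis abs_ge_minus_self abs_mult abs_of_nonneg minus_le_iff)
  ultimately have "0 \<le> curvature_term w a v du r r' + K * m * (n^2 * G * Q) + (K + K^3) * m * y^2"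
    unfolding curvature_term_def lead using main by (smt (verit))
  also have "\<dots> \<le> curvature_term w a v du r r' + (K * n^2 + K * n^4 + K^3 * n^4) * m * (G + U) * Q"
  proof -
    \<comment> \<open>Adding these two nonnegative products lets a single constant multiply
      \<open>G + U\<close>.\<close>
    have "0 \<le> K * n^2 * m * U * Q" "0 \<le> (K + K^3) * n^4 * m * G * Q"
      using nonneg K m by (auto simp: n_def)
    then show ?thesis unfolding y2 by (simp add: algebra_simps)
  qed
  finally show ?thesis .
qed

section \<open>The weak inequality\<close>

definition form_pd :: "'n::finite \<Rightarrow> 'n form_field \<Rightarrow> 'n form_field" where
  "form_pd i \<omega> x I = pd i (\<lambda>y. \<omega> y I) x"

lemma ext_d_eq: "ext_d \<omega> x I = (\<Sum>j\<in>UNIV. ewedge j (form_pd j \<omega> x) I)"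
  unfolding ext_d_def ewedge_def form_pd_def by (rule sum.mono_neutral_cong_left) auto

lemma codiff_eq: "codiff \<omega> x I = - (\<Sum>j\<in>UNIV. contr j (form_pd j \<omega> x) I)"
proof -
  have "(\<Sum>j\<in>- I. sgn2 {j} I * pd j (\<lambda>y. \<omega> y (insert j I)) x) = (\<Sum>j\<in>UNIV. contr j (form_pd j \<omega> x) I)"
    unfolding contr_def form_pd_def by (rule sum.mono_neutral_cong_left) auto
  then show ?thesis by (simp add: codiff_def)
qed

lemma Ck_on_ewedge:
  fixes \<alpha> :: "'n::{finite,linorder} form_field"
  assumes "open S" "\<And>I. Ck_on k (\<lambda>x. \<alpha> x I) S"
  shows "Ck_on k (\<lambda>x. ewedge j (\<alpha> x) I) S"
  unfolding ewedge_def using Ck_on_cmult[OF assms] by (cases "j \<in> I") simp_all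

lemma Ck_on_contr:
  fixes \<alpha> :: "'n::{finite,linorder} form_field"
  assumes "open S" "\<And>I. Ck_on k (\<lambda>x. \<alpha> x I) S"
  shows "Ck_on k (\<lambda>x. contr j (\<alpha> x) I) S"
  unfolding contr_def using Ck_on_cmult[OF assms] by (cases "j \<in> I") simp_all

lemma Ck_on_finner:
  fixes \<alpha> \<beta> :: "'n::finite form_field"
  assumes "open S" "\<And>I. Ck_on k (\<lambda>x. \<alpha> x I) S" "\<And>I. Ck_on k (\<lambda>x. \<beta> x I) S"
  shows "Ck_on k (\<lambda>x. finner (\<alpha> x) (\<beta> x)) S"
  unfolding finner_def by (intro Ck_on_sum Ck_on_mult assms)

lemma pd_ewedge:
  fixes \<alpha> :: "'n::{finite,linorder} form_field"
  assumes "\<And>I. Ck_on (Suc k) (\<lambda>x. \<alpha> x I) S" "x \<in> S"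
  shows "pd i (\<lambda>y. ewedge j (\<alpha> y) I) x = ewedge j (form_pd i \<alpha> x) I"
  unfolding ewedge_def form_pd_def using pd_cmult[OF assms] by (cases "j \<in> I") simp_all

lemma pd_contr:
  fixes \<alpha> :: "'n::{finite,linorder} form_field"
  assumes "\<And>I. Ck_on (Suc k) (\<lambda>x. \<alpha> x I) S" "x \<in> S"
  shows "pd i (\<lambda>y. contr j (\<alpha> y) I) x = contr j (form_pd i \<alpha> x) I"
  unfolding contr_def form_pd_def using pd_cmult[OF assms] by (cases "j \<in> I") simp_all

lemma pd_finner:
  fixes \<alpha> \<beta> :: "'n::finite form_field"
  assumes S: "open S" and \<alpha>: "\<And>I. Ck_on (Suc k) (\<lambda>x. \<alpha> x I) S"
    and \<beta>: "\<And>I. Ck_on (Suc k) (\<lambda>x. \<beta> x I) S" and x: "x \<in> S"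
  shows "pd i (\<lambda>y. finner (\<alpha> y) (\<beta> y)) x = finner (form_pd i \<alpha> x) (\<beta> x) + finner (\<alpha> x) (form_pd i \<beta> x)"
proof -
  have "pd i (\<lambda>y. finner (\<alpha> y) (\<beta> y)) x = (\<Sum>I\<in>UNIV. pd i (\<lambda>y. \<alpha> y I * \<beta> y I) x)"
    unfolding finner_def by (rule pd_sum[OF Ck_on_mult[OF S \<alpha> \<beta>] x])
  also have "\<dots> = finner (form_pd i \<alpha> x) (\<beta> x) + finner (\<alpha> x) (form_pd i \<beta> x)"
    unfolding pd_mult(2)[OF \<alpha> \<beta> x] finner_def form_pd_def by (rule sum.distrib)
  finally show ?thesis .
qed

context
  fixes \<Omega> :: "((real,'n::{finite,linorder}) vec) set" and \<omega> u :: "'n form_field" and \<rho> \<rho>' :: "real \<Rightarrow> real"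
begin

definition normsq :: "(real,'n) vec \<Rightarrow> real" where
  "normsq x = finner (\<omega> x) (\<omega> x)"

text \<open>The form F of the overview.\<close>

definition current :: "'n form_field" where
  "current x = (\<lambda>I. \<rho> (normsq x) * \<omega> x I)"

definition curvature :: "(real,'n) vec \<Rightarrow> real" where
  "curvature x = curvature_term (\<omega> x) (\<lambda>i. form_pd i \<omega> x) (\<lambda>l. u x {l})
     (\<lambda>i l. pd i (\<lambda>y. u y {l}) x) (\<rho> (normsq x)) (\<rho>' (normsq x))"

context
  assumes \<Omega>: "open \<Omega>"
    and \<omega>2: "\<And>I. Ck_on 2 (\<lambda>x. \<omega> x I) \<Omega>"
    and u1: "\<And>I. Ck_on (Suc 0) (\<lambda>x. u x I) \<Omega>"
    and \<rho>: "\<And>s. s \<ge> 0 \<Longrightarrow> (\<rho> has_real_derivative \<rho>' s) (at s within {0..})"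
    and \<rho>': "continuous_on {0..} \<rho>'"
    and coclosed: "\<And>x I. x \<in> \<Omega> \<Longrightarrow> codiff (\<lambda>y J. \<rho> (finner (\<omega> y) (\<omega> y)) * \<omega> y J) x I = 0"
    and d\<omega>: "\<And>x I. x \<in> \<Omega> \<Longrightarrow> ext_d \<omega> x I = vwedge (\<lambda>l. u x {l}) (\<omega> x) I"
begin

lemma form_C1: "Ck_on (Suc 0) (\<lambda>x. \<omega> x I) \<Omega>"
  using Ck_on_SucD[of "Suc 0"] \<omega>2[of I] by (simp add: numeral_2_eq_2 del: Ck_on.simps)

lemma normsq_nonneg: "0 \<le> normsq x"
  by (simp add: normsq_def finner_self_nonneg)

lemma normsq_C1: "Ck_on (Suc 0) normsq \<Omega>"
  unfolding normsq_def[abs_def] by (intro Ck_on_finner \<Omega> form_C1)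

lemma pd_normsq: "x \<in> \<Omega> \<Longrightarrow> pd i normsq x = 2 * finner (\<omega> x) (form_pd i \<omega> x)"
  unfolding normsq_def[abs_def]
  using pd_finner[OF \<Omega> form_C1 form_C1, of x i] by (simp add: finner_commute)

lemma density_C1: "Ck_on (Suc 0) (\<lambda>x. \<rho> (normsq x)) \<Omega>"
  by (rule Ck_on_compose_halfline(1)[OF \<Omega> normsq_C1 normsq_nonneg _ \<rho>']) (rule \<rho>)

lemma pd_density: "x \<in> \<Omega> \<Longrightarrow> pd i (\<lambda>x. \<rho> (normsq x)) x = \<rho>' (normsq x) * pd i normsq x"
  by (rule Ck_on_compose_halfline(2)[OF \<Omega> normsq_C1 normsq_nonneg _ \<rho>']) (rule \<rho>)

lemma current_C1: "Ck_on (Suc 0) (\<lambda>x. current x I) \<Omega>"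
  unfolding current_def by (intro Ck_on_mult \<Omega> form_C1 density_C1)

lemma form_pd_current:
  assumes "x \<in> \<Omega>"
  shows "form_pd i current x =
    (\<lambda>I. \<rho>' (normsq x) * pd i normsq x * \<omega> x I + \<rho> (normsq x) * form_pd i \<omega> x I)"
proof
  fix I
  show "form_pd i current x I = \<rho>' (normsq x) * pd i normsq x * \<omega> x I + \<rho> (normsq x) * form_pd i \<omega> x I"
    unfolding form_pd_def current_def
    using pd_mult(2)[OF density_C1 form_C1 assms] pd_density[OF assms] by simp
qed

lemma sum_contr_current: "x \<in> \<Omega> \<Longrightarrow> (\<Sum>j\<in>UNIV. contr j (form_pd j current x) I) = 0"
  using coclosed[of x I] codiff_eq[of current x I]
  by (simp add: current_def[abs_def] normsq_def)

lemma sum_ewedge_form: "x \<in> \<Omega> \<Longrightarrow> (\<Sum>j\<in>UNIV. ewedge j (form_pd j \<omega> x) I) = vwedge (\<lambda>l. u x {l}) (\<omega> x) I"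
  using d\<omega>[of x I] by (simp add: ext_d_eq)

text \<open>Continuity makes the tested remainder \<open>W\<close> in
  \<open>weak_subsolution\<close> integrable.\<close>

lemma continuous_on_curvature: "continuous_on \<Omega> curvature"
proof -
  have fp: "Ck_on 0 (\<lambda>x. form_pd i \<omega> x I) \<Omega>" for i I
    unfolding form_pd_def by (rule Ck_on_pd[OF form_C1])
  have w: "Ck_on 0 (\<lambda>x. \<omega> x I) \<Omega>" for I
    by (rule Ck_on_SucD[OF form_C1])
  have Q: "continuous_on \<Omega> normsq"
    by (rule Ck_on_imp_continuous_on[OF normsq_C1])
  have r: "continuous_on \<Omega> (\<lambda>x. \<rho> (normsq x))"
    using density_C1 by (rule Ck_on_imp_continuous_on)
  have r': "continuous_on \<Omega> (\<lambda>x. \<rho>' (normsq x))"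
    by (rule continuous_on_compose2[OF \<rho>' Q]) (auto simp: normsq_nonneg)
  have u: "continuous_on \<Omega> (\<lambda>x. u x {l})" "continuous_on \<Omega> (\<lambda>x. pd i (\<lambda>y. u y {l}) x)" for i l
    using u1[of "{l}"] by auto
  have inner: "continuous_on \<Omega> (\<lambda>x. finner (\<omega> x) (form_pd i \<omega> x))"
    "continuous_on \<Omega> (\<lambda>x. finner (form_pd i \<omega> x) (form_pd i \<omega> x))"
    "continuous_on \<Omega> (\<lambda>x. finner (ewedge l (\<omega> x)) (ewedge i (\<omega> x)))"
    "continuous_on \<Omega> (\<lambda>x. finner (ewedge l (form_pd i \<omega> x)) (ewedge i (\<omega> x)))" for i l
    by (rule Ck_on_imp_continuous_on[of 0], intro Ck_on_finner Ck_on_ewedge \<Omega> fp w)+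
  show ?thesis
    unfolding curvature_def[abs_def] curvature_term_def
    by (intro continuous_intros r r' u inner)
qed

text \<open>\<open>D1\<close> and \<open>D2\<close> have integral zero, and on \<Omega> their sum is
  the flux paired with \<open>grad \<phi>\<close> plus \<open>\<phi> x * curvature x\<close>. The
  integrand is therefore \<open>W - D1 - D2\<close>, with \<open>W\<close> nonnegative because
  \<open>M\<close> compensates the negative part of the curvature.\<close>

lemma weak_subsolution:
  assumes M: "continuous_on \<Omega> M" "\<And>x. x \<in> \<Omega> \<Longrightarrow> 0 \<le> curvature x + M x"
    and \<phi>: "Ck_on 2 \<phi> UNIV" "\<And>x. 0 \<le> \<phi> x"
    and T: "compact T" "T \<subseteq> \<Omega>" "\<And>x. x \<notin> T \<Longrightarrow> \<phi> x = 0"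
  shows "\<exists>J. ((\<lambda>x. - (Vflux ((-1) ^ CARD('n)) \<rho> \<rho>' \<omega> x (grad normsq x) \<bullet> grad \<phi> x) + M x * \<phi> x)
    has_integral J) \<Omega> \<and> 0 \<le> J"
proof -
  define f where "f i I y = contr i (current y) I" for i I y
  define \<psi> where "\<psi> j I y = \<phi> y * contr j (\<omega> y) I" for j I y
  \<comment> \<open>The second term of the flux formula in the overview. It is C^1, so its product
    with \<open>\<phi>\<close> can be differentiated directly.\<close>
  define G where "G i y = (\<Sum>l\<in>UNIV. u y {l} * finner (ewedge l (current y)) (ewedge i (\<omega> y)))" for i y
  \<comment> \<open>Each summand integrates to zero by \<open>integral_pd_mult_pd_swap\<close>. The
    subtracted products add up to zero pointwise because F is coclosed, so they replace the missing
    second derivatives of F at no cost.\<close>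
  define D1 where "D1 x = (\<Sum>i\<in>UNIV. \<Sum>j\<in>UNIV. \<Sum>I\<in>UNIV.
    pd j (f i I) x * pd i (\<psi> j I) x - pd i (f i I) x * pd j (\<psi> j I) x)" for x
  define D2 where "D2 x = (\<Sum>i\<in>UNIV. pd i (\<lambda>y. \<phi> y * G i y) x)" for x
  have clT: "closed T" using T(1) by (rule compact_imp_closed)
  have \<phi>\<Omega>: "Ck_on 2 \<phi> \<Omega>"
    using Ck_on_mono[OF \<phi>(1)] by simp
  have \<phi>1: "Ck_on (Suc 0) \<phi> \<Omega>"
    using Ck_on_SucD[of "Suc 0"] \<phi>\<Omega> by (simp add: numeral_2_eq_2 del: Ck_on.simps)
  have f1: "Ck_on (Suc 0) (f i I) \<Omega>" for i I
    unfolding f_def by (intro Ck_on_contr \<Omega> current_C1)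
  have \<psi>2: "Ck_on 2 (\<psi> j I) \<Omega>" for j I
    unfolding \<psi>_def by (intro Ck_on_mult Ck_on_contr \<Omega> \<phi>\<Omega> \<omega>2)
  have \<psi>0: "x \<notin> T \<Longrightarrow> \<psi> j I x = 0" for j I x
    by (simp add: \<psi>_def T(3))
  have G1: "Ck_on (Suc 0) (G i) \<Omega>" for i
    unfolding G_def by (intro Ck_on_sum Ck_on_mult Ck_on_finner Ck_on_ewedge \<Omega> u1 current_C1 form_C1)

  have pointwise: "D1 x + D2 x = Vflux ((-1) ^ CARD('n)) \<rho> \<rho>' \<omega> x (grad normsq x) \<bullet> grad \<phi> x + \<phi> x * curvature x"
    if x: "x \<in> \<Omega>" for x
  proof -
    let ?w = "\<omega> x" and ?a = "\<lambda>i. form_pd i \<omega> x" and ?b = "\<lambda>i. form_pd i current x"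
      and ?v = "\<lambda>l. u x {l}" and ?r = "\<rho> (normsq x)" and ?r' = "\<rho>' (normsq x)"
      and ?du = "\<lambda>i l. pd i (\<lambda>y. u y {l}) x"
    have cur: "current x = (\<lambda>I. ?r * ?w I)" by (simp add: current_def)
    have pf: "pd j (f i I) x = contr i (?b j) I" for i j I
      unfolding f_def by (rule pd_contr[OF current_C1 x])
    have p\<psi>: "pd i (\<psi> j I) x = pd i \<phi> x * contr j ?w I + \<phi> x * contr j (?a i) I" for i j I
      unfolding \<psi>_def
      using pd_mult(2)[OF \<phi>1 Ck_on_contr[OF \<Omega> form_C1] x] pd_contr[OF form_C1 x] by simp
    \<comment> \<open>Summing over \<open>i\<close> first produces the codifferential of F up to
      sign.\<close>
    have "(\<Sum>i\<in>UNIV. \<Sum>j\<in>UNIV. \<Sum>I\<in>UNIV. pd i (f i I) x * pd j (\<psi> j I) x)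
      = (\<Sum>j\<in>UNIV. \<Sum>I\<in>UNIV. \<Sum>i\<in>UNIV. pd i (f i I) x * pd j (\<psi> j I) x)"
      by (subst sum.swap) (intro sum.cong refl sum.swap)
    also have "\<dots> = 0"
      unfolding sum_distrib_right[symmetric] pf sum_contr_current[OF x] by simp
    finally have "D1 x = (\<Sum>i\<in>UNIV. \<Sum>j\<in>UNIV. \<Sum>I\<in>UNIV. pd j (f i I) x * pd i (\<psi> j I) x)"
      unfolding D1_def sum_subtractf by simp
    also have "\<dots> = (\<Sum>i\<in>UNIV. pd i \<phi> x * (\<Sum>j\<in>UNIV. finner (contr i (?b j)) (contr j ?w)))
        + \<phi> x * (\<Sum>i\<in>UNIV. \<Sum>j\<in>UNIV. finner (contr i (?b j)) (contr j (?a i)))"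
      unfolding pf p\<psi> finner_def by (simp add: distrib_left sum.distrib sum_distrib_left mult.left_commute)
    finally have D1: "D1 x = \<dots>" .
    have inner: "pd i (\<lambda>y. finner (ewedge l (current y)) (ewedge i (\<omega> y))) x
      = finner (ewedge l (?b i)) (ewedge i ?w) + finner (ewedge l (current x)) (ewedge i (?a i))" for i l
    proof -
      have 1: "form_pd i (\<lambda>y. ewedge l (\<alpha> y)) x = ewedge l (form_pd i \<alpha> x)"
        if "\<And>I. Ck_on (Suc 0) (\<lambda>x. \<alpha> x I) \<Omega>" for \<alpha> l
        using pd_ewedge[OF that x] by (simp add: form_pd_def[abs_def] fun_eq_iff)
      show ?thesis
        using pd_finner[OF \<Omega> Ck_on_ewedge[OF \<Omega> current_C1] Ck_on_ewedge[OF \<Omega> form_C1] x]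
          1[OF current_C1] 1[OF form_C1] by simp
    qed
    have pG: "pd i (G i) x = (\<Sum>l\<in>UNIV. ?du i l * finner (ewedge l (current x)) (ewedge i ?w)
        + ?v l * (finner (ewedge l (?b i)) (ewedge i ?w) + finner (ewedge l (current x)) (ewedge i (?a i))))" for i
    proof -
      note C = Ck_on_finner[OF \<Omega> Ck_on_ewedge[OF \<Omega> current_C1] Ck_on_ewedge[OF \<Omega> form_C1]]
      have "pd i (G i) x = (\<Sum>l\<in>UNIV. pd i (\<lambda>y. u y {l} * finner (ewedge l (current y)) (ewedge i (\<omega> y))) x)"
        unfolding G_def by (rule pd_sum[OF Ck_on_mult[OF \<Omega> u1 C] x])
      then show ?thesis
        unfolding pd_mult(2)[OF u1 C x] inner .
    qed
    have D2: "D2 x = (\<Sum>i\<in>UNIV. pd i \<phi> x * G i x) + \<phi> x * (\<Sum>i\<in>UNIV. pd i (G i) x)"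
      unfolding D2_def pd_mult(2)[OF \<phi>1 G1 x] sum.distrib sum_distrib_left ..
    \<comment> \<open>At \<open>x\<close> these are the three assumptions of the pointwise
      identities: the equation for d\<omega>, the gradient of Q and the product rule for F.\<close>
    note assms = sum_ewedge_form[OF x] pd_normsq[OF x] form_pd_current[OF x]
    have "D1 x + D2 x = (\<Sum>i\<in>UNIV. pd i \<phi> x * ((\<Sum>j\<in>UNIV. finner (contr i (?b j)) (contr j ?w)) + G i x))
      + \<phi> x * (\<Sum>i\<in>UNIV. (\<Sum>j\<in>UNIV. finner (contr i (?b j)) (contr j (?a i))) + pd i (G i) x)"
      unfolding D1 D2 by (simp add: sum.distrib distrib_left)
    also have "\<dots> = (?r / 2 + finner ?w ?w * ?r') * (\<Sum>i\<in>UNIV. pd i normsq x * pd i \<phi> x)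
        - ?r' * finner (vwedge (\<lambda>i. pd i normsq x) ?w) (vwedge (\<lambda>i. pd i \<phi> x) ?w) + \<phi> x * curvature x"
      unfolding pG unfolding G_def cur flux_identity[OF assms] curvature_identity[OF assms] curvature_def ..
    also have "\<dots> = Vflux ((-1) ^ CARD('n)) \<rho> \<rho>' \<omega> x (grad normsq x) \<bullet> grad \<phi> x + \<phi> x * curvature x"
    proof -
      have "($) (grad h x) = (\<lambda>i. pd i h x)" for h :: "(real,'n) vec \<Rightarrow> real"
        by (auto simp: grad_def)
      then show ?thesis
        unfolding Vflux_inner by (simp add: normsq_def inner_vec_def grad_def)
    qed
    finally show ?thesis .
  qed

  define W where "W x = \<phi> x * (curvature x + M x)" for x
  have "continuous_on \<Omega> W"
    unfolding W_def using M(1) continuous_on_curvature Ck_on_imp_continuous_on[OF \<phi>1]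
    by (intro continuous_intros)
  then have "Ck_on 0 W UNIV"
    by (intro Ck_on_UNIV_of_support[OF \<Omega> clT T(2)]) (auto simp: W_def T(3))
  then have Wint: "integrable lborel W"
    using T by (intro integrable_compact_support[of W T]) (auto simp: W_def)
  have W0: "0 \<le> W x" for x
    using M(2)[of x] \<phi>(2)[of x] T by (cases "x \<in> T") (auto simp: W_def)

  have D1int: "integrable lborel D1" "integral\<^sup>L lborel D1 = 0"
  proof -
    note I = integral_pd_mult_pd_swap[OF \<Omega> f1 \<psi>2 T(1,2) \<psi>0]
    show "integrable lborel D1"
      unfolding D1_def[abs_def] by (intro Bochner_Integration.integrable_sum I(1))
    show "integral\<^sup>L lborel D1 = 0"
      unfolding D1_def[abs_def] by (simp add: I Bochner_Integration.integrable_sum)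
  qed
  have D2int: "integrable lborel D2" "integral\<^sup>L lborel D2 = 0"
  proof -
    have "Ck_on (Suc 0) (\<lambda>y. \<phi> y * G i y) UNIV" for i
      by (rule Ck_on_UNIV_of_support[OF \<Omega> clT T(2) Ck_on_mult[OF \<Omega> \<phi>1 G1]]) (simp add: T(3))
    note I = integral_pd_eq_0[OF this T(1)]
    have I1: "integrable lborel (pd i (\<lambda>y. \<phi> y * G i y))" and I2: "integral\<^sup>L lborel (pd i (\<lambda>y. \<phi> y * G i y)) = 0" for i
      using I[of i i] T(3) by auto
    show "integrable lborel D2"
      unfolding D2_def[abs_def] by (intro Bochner_Integration.integrable_sum I1)
    show "integral\<^sup>L lborel D2 = 0"
      unfolding D2_def[abs_def] by (subst Bochner_Integration.integral_sum) (simp_all add: I1 I2)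
  qed

  let ?H = "\<lambda>x. - (Vflux ((-1) ^ CARD('n)) \<rho> \<rho>' \<omega> x (grad normsq x) \<bullet> grad \<phi> x) + M x * \<phi> x"
  \<comment> \<open>Outside \<Omega> every term vanishes because the supports lie in
    \<open>T\<close>, so the integral over \<Omega> becomes one over the whole space.\<close>
  have H: "?H x = W x - D1 x - D2 x" for x
  proof (cases "x \<in> \<Omega>")
    case True
    then show ?thesis using pointwise[OF True] by (simp add: W_def algebra_simps)
  next
    case False
    then have x: "x \<notin> T" using T(2) by auto
    have "grad \<phi> x = 0"
      using pd_eq_0_outside[OF clT T(3) x] by (simp add: grad_def vec_eq_iff)
    moreover have "D1 x = 0"
      unfolding D1_def using pd_eq_0_outside[OF clT \<psi>0 x] by simp
    moreover have "D2 x = 0"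
      unfolding D2_def using pd_eq_0_outside[OF clT _ x, of "\<lambda>y. \<phi> y * G _ y"] T(3) by simp
    ultimately show ?thesis by (simp add: W_def T(3)[OF x])
  qed
  have "integrable lborel ?H"
    unfolding H using Wint D1int(1) D2int(1) by simp
  then have "(?H has_integral integral\<^sup>L lborel ?H) UNIV"
    by (rule has_integral_integral_lborel)
  moreover have "?H x = 0" if "x \<notin> \<Omega>" for x
  proof -
    have x: "x \<notin> T" using T(2) that by auto
    then have "grad \<phi> x = 0"
      using pd_eq_0_outside[OF clT T(3) x] by (simp add: grad_def vec_eq_iff)
    then show ?thesis by (simp add: T(3)[OF x])
  qed
  then have "(\<lambda>x. if x \<in> \<Omega> then ?H x else 0) = ?H" by auto
  ultimately have "(?H has_integral integral\<^sup>L lborel ?H) \<Omega>"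
    using has_integral_restrict_UNIV[of \<Omega> ?H] by simp
  moreover have "integral\<^sup>L lborel ?H = integral\<^sup>L lborel W"
    unfolding H using Wint D1int D2int by simp
  moreover have "0 \<le> integral\<^sup>L lborel W"
    by (rule Bochner_Integration.integral_nonneg) (rule W0)
  ultimately show ?thesis by auto
qed

end

end

section \<open>Ellipticity and the theorem\<close>

text \<open>The quadratic form is affine in |\<xi> \<and> \<omega>|^2, which ranges within
  [0, |\<xi>|^2 Q]. At the two ends its coefficients are \<open>f\<close> = (\<rho> + 2 Q \<rho>')/2
  and \<open>e\<close> = \<rho>/2, so it lies between them. Condition [U] bounds \<open>f\<close>,
  and the two density lemmas bound \<open>e\<close>.\<close>

lemma Vflux_elliptic:
  fixes \<omega> :: "'n::{finite,linorder} form_field" and x \<xi> :: "(real,'n) vec"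
    and \<rho> \<rho>' :: "real \<Rightarrow> real" and K k q :: real
  defines "m \<equiv> rpow (finner (\<omega> x) (\<omega> x) + k) q"
  assumes D: "\<And>t. t \<ge> 0 \<Longrightarrow> (\<rho> has_real_derivative \<rho>' t) (at t within {0..})"
    and nonneg: "\<And>t. t \<ge> 0 \<Longrightarrow> 0 \<le> \<rho> t"
    and K: "0 < K" and k: "0 \<le> k" and q: "0 \<le> q"
    and lower: "\<And>t. t \<ge> 0 \<Longrightarrow> rpow (t + k) q / K \<le> \<rho> t + 2 * t * \<rho>' t"
    and upper: "\<And>t. t \<ge> 0 \<Longrightarrow> \<rho> t + 2 * t * \<rho>' t \<le> K * rpow (t + k) q"
  shows "m / (4 * K * 4 powr q) * (norm \<xi>)\<^sup>2 \<le> Vflux ((-1) ^ CARD('n)) \<rho> \<rho>' \<omega> x \<xi> \<bullet> \<xi>"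
    and "Vflux ((-1) ^ CARD('n)) \<rho> \<rho>' \<omega> x \<xi> \<bullet> \<xi> \<le> K * m / 2 * (norm \<xi>)\<^sup>2"
proof -
  define Q where "Q = finner (\<omega> x) (\<omega> x)"
  define N where "N = (norm \<xi>)\<^sup>2"
  define Y where "Y = finner (vwedge (($) \<xi>) (\<omega> x)) (vwedge (($) \<xi>) (\<omega> x))"
  define e where "e = \<rho> Q / 2"
  define f where "f = (\<rho> Q + 2 * Q * \<rho>' Q) / 2"
  define V where "V = Vflux ((-1) ^ CARD('n)) \<rho> \<rho>' \<omega> x \<xi> \<bullet> \<xi>"
  define lam where "lam = m / (4 * K * 4 powr q)"
  have Q: "0 \<le> Q" by (simp add: Q_def finner_self_nonneg)
  have m: "m = rpow (Q + k) q" "0 \<le> m" by (simp_all add: m_def Q_def rpow_nonneg)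
  have N: "N = \<xi> \<bullet> \<xi>" "0 \<le> N" by (simp_all add: N_def power2_norm_eq_inner)
  have Y: "0 \<le> Y" "Y \<le> N * Q"
    using vwedge_norm_le[of "($) \<xi>" "\<omega> x"]
    by (simp_all add: Y_def finner_self_nonneg Q_def N inner_vec_def power2_eq_square)
  have V: "V = (\<rho> Q / 2 + Q * \<rho>' Q) * N - \<rho>' Q * Y"
    unfolding V_def Vflux_inner Q_def[symmetric] Y_def[symmetric] N ..
  \<comment> \<open>Two expansions, from the ends \<open>Y = N * Q\<close> and \<open>Y = 0\<close>;
    the sign of \<open>\<rho>' Q\<close> decides which one gives the lower bound.\<close>
  have Ve: "V = e * N + \<rho>' Q * (N * Q - Y)" and Vf: "V = f * N - \<rho>' Q * Y"
    by (simp_all add: V e_def f_def algebra_simps)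
  have pow: "1 \<le> 4 powr q" using q by (simp add: ge_one_powr_ge_zero)
  have "lam \<le> e"
    using density_ge[of \<rho> \<rho>' K k q Q, OF D K k q lower upper Q nonneg] K
    by (simp add: lam_def e_def m)
  have "m / (4 * K * 4 powr q) \<le> m / (2 * K)"
    using m pow K by (intro divide_left_mono) auto
  then have "lam \<le> f"
    using lower[OF Q] K by (simp add: lam_def f_def m)
  have "e \<le> K * m / 2"
    using density_le[of \<rho> \<rho>' K k q Q, OF D K k q lower upper Q] by (simp add: e_def m)
  have "f \<le> K * m / 2"
    using upper[OF Q] by (simp add: f_def m)
  have min_max: "min e f * N \<le> V \<and> V \<le> max e f * N"
  proof (cases "0 \<le> \<rho>' Q")
    case True
    then have "0 \<le> \<rho>' Q * (N * Q - Y)" "0 \<le> \<rho>' Q * Y" using Y by auto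
    then have "e * N \<le> V" "V \<le> f * N" using Ve Vf by linarith+
    then show ?thesis
      using N mult_right_mono[of "min e f" e N] mult_right_mono[of f "max e f" N] by auto
  next
    case False
    then have "\<rho>' Q * (N * Q - Y) \<le> 0" "\<rho>' Q * Y \<le> 0" using Y by (auto intro: mult_nonpos_nonneg)
    then have "f * N \<le> V" "V \<le> e * N" using Ve Vf by linarith+
    then show ?thesis
      using N mult_right_mono[of "min e f" f N] mult_right_mono[of e "max e f" N] by auto
  qed
  have le: "lam \<le> min e f" "max e f \<le> K * m / 2"
    using \<open>lam \<le> e\<close> \<open>lam \<le> f\<close> \<open>e \<le> K * m / 2\<close> \<open>f \<le> K * m / 2\<close> by simp_all
  show "m / (4 * K * 4 powr q) * (norm \<xi>)\<^sup>2 \<le> Vflux ((-1) ^ CARD('n)) \<rho> \<rho>' \<omega> x \<xi> \<bullet> \<xi>"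
    and "Vflux ((-1) ^ CARD('n)) \<rho> \<rho>' \<omega> x \<xi> \<bullet> \<xi> \<le> K * m / 2 * (norm \<xi>)\<^sup>2"
    using min_max mult_right_mono[OF le(1) N(2)] mult_right_mono[OF le(2) N(2)]
    unfolding V_def[symmetric] N_def[symmetric] lam_def by linarith+
qed

lemma abs_pd_le_grad_norm: "\<bar>pd i (\<lambda>y. u y I) x\<bar> \<le> grad_norm u x"
proof -
  have "(pd i (\<lambda>y. u y I) x)\<^sup>2 \<le> (\<Sum>I\<in>UNIV. (pd i (\<lambda>y. u y I) x)\<^sup>2)"
    by (rule member_le_sum) auto
  also have "\<dots> \<le> (\<Sum>i\<in>UNIV. \<Sum>I\<in>UNIV. (pd i (\<lambda>y. u y I) x)\<^sup>2)"
    by (rule member_le_sum[where f = "\<lambda>i. \<Sum>I\<in>UNIV. (pd i (\<lambda>y. u y I) x)\<^sup>2"]) (auto intro: sum_nonneg)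
  finally show ?thesis
    unfolding grad_norm_def by (intro real_le_rsqrt) simp
qed

lemma finner_component_le: "(\<alpha> I)\<^sup>2 \<le> finner \<alpha> \<alpha>" for \<alpha> :: "'n::finite form"
  unfolding finner_def power2_eq_square[symmetric] by (rule member_le_sum) auto

text \<open>The flux contains \<rho>'(Q), in general only continuous, so its divergence is taken
  weakly, against nonnegative smooth functions with compact support in \<Omega>. Uniform ellipticity
  bounds the ratio of the two ellipticity constants by one \<Lambda>; \<open>lam\<close> itself may
  vary with the point, as Q need not be bounded on \<Omega>.\<close>

theorem theorem1:
  fixes p :: nat
  assumes "p \<ge> 1"
  shows "\<exists>\<sigma>::real. \<sigma> \<in> {-1, 1} \<and>
    (\<forall>(\<Omega>::((real,'n::{finite,linorder}) vec) set) (\<omega>::'n form_field) (u::'n form_field)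
        (\<rho>::real \<Rightarrow> real) (\<rho>'::real \<Rightarrow> real) (K::real) (k::real) (q::real).
      open \<Omega> \<and> bounded \<Omega> \<and> connected \<Omega> \<and> \<Omega> \<noteq> {} \<and>
      has_degree \<omega> p \<and> has_degree u 1 \<and>
      smooth_form_on \<omega> \<Omega> \<and> smooth_form_on u \<Omega> \<and>
      (\<forall>s\<ge>0. \<rho> s \<ge> 0) \<and>
      (\<forall>s\<ge>0. (\<rho> has_real_derivative \<rho>' s) (at s within {0..})) \<and>
      continuous_on {0..} \<rho>' \<and>
      K > 0 \<and> k \<ge> 0 \<and> q \<ge> 0 \<and>
      (\<forall>s\<ge>0. rpow (s + k) q / K \<le> \<rho> s + 2 * s * \<rho>' s \<and>
              \<rho> s + 2 * s * \<rho>' s \<le> K * rpow (s + k) q) \<and>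
      (\<forall>x\<in>\<Omega>. \<forall>I. codiff (\<lambda>y J. \<rho> (finner (\<omega> y) (\<omega> y)) * \<omega> y J) x I = 0) \<and>
      (\<forall>x\<in>\<Omega>. \<forall>I. ext_d \<omega> x I = wedge (u x) (\<omega> x) I)
    \<longrightarrow>
      (let Q = (\<lambda>x. finner (\<omega> x) (\<omega> x)) in
        (\<exists>C>0. \<forall>\<phi>::(real,'n) vec \<Rightarrow> real.
            Cinf_on \<phi> UNIV \<and> (\<forall>x. \<phi> x \<ge> 0) \<and>
            (\<exists>S. compact S \<and> S \<subseteq> \<Omega> \<and> (\<forall>x. x \<notin> S \<longrightarrow> \<phi> x = 0))
            \<longrightarrow> (\<exists>J. ((\<lambda>x. - (Vflux \<sigma> \<rho> \<rho>' \<omega> x (grad Q x) \<bullet> grad \<phi> x)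
                           + C * rpow (Q x + k) q * (grad_norm u x + finner (u x) (u x))
                             * Q x * \<phi> x) has_integral J) \<Omega> \<and> J \<ge> 0))
        \<and> (k > 0 \<longrightarrow>
            (\<exists>\<Lambda>. \<forall>x\<in>\<Omega>. \<exists>lam>0. \<forall>\<xi>::(real,'n) vec.
               lam * norm \<xi> ^ 2 \<le> Vflux \<sigma> \<rho> \<rho>' \<omega> x \<xi> \<bullet> \<xi> \<and>
               Vflux \<sigma> \<rho> \<rho>' \<omega> x \<xi> \<bullet> \<xi> \<le> \<Lambda> * lam * norm \<xi> ^ 2))))"
proof (intro exI[of _ "(-1) ^ CARD('n)"] conjI allI impI)
  show "(-1::real) ^ CARD('n) \<in> {-1, 1}"
    by (cases "even CARD('n)") auto
next
  fix \<Omega> :: "((real,'n) vec) set" and \<omega> u :: "'n form_field" and \<rho> \<rho>' :: "real \<Rightarrow> real" and K k q :: real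
  assume hyps: "open \<Omega> \<and> bounded \<Omega> \<and> connected \<Omega> \<and> \<Omega> \<noteq> {} \<and>
      has_degree \<omega> p \<and> has_degree u 1 \<and>
      smooth_form_on \<omega> \<Omega> \<and> smooth_form_on u \<Omega> \<and>
      (\<forall>s\<ge>0. \<rho> s \<ge> 0) \<and>
      (\<forall>s\<ge>0. (\<rho> has_real_derivative \<rho>' s) (at s within {0..})) \<and>
      continuous_on {0..} \<rho>' \<and>
      K > 0 \<and> k \<ge> 0 \<and> q \<ge> 0 \<and>
      (\<forall>s\<ge>0. rpow (s + k) q / K \<le> \<rho> s + 2 * s * \<rho>' s \<and>
              \<rho> s + 2 * s * \<rho>' s \<le> K * rpow (s + k) q) \<and>
      (\<forall>x\<in>\<Omega>. \<forall>I. codiff (\<lambda>y J. \<rho> (finner (\<omega> y) (\<omega> y)) * \<omega> y J) x I = 0) \<and>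
      (\<forall>x\<in>\<Omega>. \<forall>I. ext_d \<omega> x I = wedge (u x) (\<omega> x) I)"
  have \<Omega>: "open \<Omega>" and u_deg: "has_degree u 1"
    and smooth: "smooth_form_on \<omega> \<Omega>" "smooth_form_on u \<Omega>"
    and nonneg: "\<And>t. t \<ge> 0 \<Longrightarrow> 0 \<le> \<rho> t"
    and D: "\<And>t. t \<ge> 0 \<Longrightarrow> (\<rho> has_real_derivative \<rho>' t) (at t within {0..})"
    and cont: "continuous_on {0..} \<rho>'"
    and K: "0 < K" and k: "0 \<le> k" and q: "0 \<le> q"
    and lower: "\<And>t. t \<ge> 0 \<Longrightarrow> rpow (t + k) q / K \<le> \<rho> t + 2 * t * \<rho>' t"
    and upper: "\<And>t. t \<ge> 0 \<Longrightarrow> \<rho> t + 2 * t * \<rho>' t \<le> K * rpow (t + k) q"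
    and coclosed: "\<And>x I. x \<in> \<Omega> \<Longrightarrow> codiff (\<lambda>y J. \<rho> (finner (\<omega> y) (\<omega> y)) * \<omega> y J) x I = 0"
    and d\<omega>: "\<And>x I. x \<in> \<Omega> \<Longrightarrow> ext_d \<omega> x I = wedge (u x) (\<omega> x) I"
    using hyps by auto
  have "wedge (u x) (\<omega> x) = vwedge (\<lambda>l. u x {l}) (\<omega> x)" for x
    by (rule wedge_degree_one) (use u_deg in \<open>simp add: has_degree_def\<close>)
  with d\<omega> have d\<omega>': "\<And>x I. x \<in> \<Omega> \<Longrightarrow> ext_d \<omega> x I = vwedge (\<lambda>l. u x {l}) (\<omega> x) I" by simp
  have \<omega>2: "Ck_on 2 (\<lambda>x. \<omega> x I) \<Omega>" and u1: "Ck_on (Suc 0) (\<lambda>x. u x I) \<Omega>" for I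
    using smooth unfolding smooth_form_on_def Cinf_on_def by blast+
  let ?Q = "\<lambda>x. finner (\<omega> x) (\<omega> x)"
  have Q: "normsq \<omega> = ?Q" by (simp add: normsq_def[abs_def])
  define n where "n = real CARD('n)"
  \<comment> \<open>The constant of \<open>curvature_term_ge\<close>; it depends only on
    \<open>K\<close> and the dimension.\<close>
  define C where "C = K * n^2 + K * n^4 + K^3 * n^4"
  define M where "M x = C * rpow (?Q x + k) q * (grad_norm u x + finner (u x) (u x)) * ?Q x" for x
  have C: "0 < C" using K by (simp add: C_def n_def add_pos_pos)
  have "Ck_on 0 (\<lambda>x. \<omega> x I) \<Omega>" "Ck_on 0 (\<lambda>x. u x I) \<Omega>" for I
    using smooth unfolding smooth_form_on_def Cinf_on_def by blast+
  then have contQ: "continuous_on \<Omega> ?Q" and contU: "continuous_on \<Omega> (\<lambda>x. finner (u x) (u x))"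
    using Ck_on_finner[OF \<Omega>, of 0] by auto
  have "continuous_on \<Omega> (\<lambda>x. pd i (\<lambda>y. u y I) x)" for i I
    using u1[of I] by simp
  then have M: "continuous_on \<Omega> M"
    unfolding M_def grad_norm_def
    by (intro continuous_intros continuous_on_rpow contQ contU) (auto simp: finner_self_nonneg k q)
  have curv: "0 \<le> curvature \<omega> u \<rho> \<rho>' x + M x" for x
    unfolding curvature_def M_def C_def n_def Q
  proof (rule curvature_term_ge)
    show "\<rho> (?Q x) \<le> K * rpow (?Q x + k) q"
      by (rule density_le[of \<rho> \<rho>', OF D K k q lower upper finner_self_nonneg])
    show "\<bar>pd i (\<lambda>y. u y {l}) x\<bar> \<le> grad_norm u x" for i l
      by (rule abs_pd_le_grad_norm)
  qed (use K in \<open>auto simp: nonneg lower rpow_nonneg finner_self_nonneg finner_component_le\<close>)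
  have 1: "\<exists>J. ((\<lambda>x. - (Vflux ((-1) ^ CARD('n)) \<rho> \<rho>' \<omega> x (grad ?Q x) \<bullet> grad \<phi> x) + M x * \<phi> x)
      has_integral J) \<Omega> \<and> 0 \<le> J"
    if "Cinf_on \<phi> UNIV" "\<forall>x. \<phi> x \<ge> 0" "compact S" "S \<subseteq> \<Omega>" "\<forall>x. x \<notin> S \<longrightarrow> \<phi> x = 0" for \<phi> S
    unfolding Q[symmetric]
    by (rule weak_subsolution[OF \<Omega> \<omega>2 u1 D cont coclosed d\<omega>' M curv])
       (use that in \<open>auto simp: Cinf_on_def simp del: Ck_on.simps\<close>)
  \<comment> \<open>\<open>2 * K\<^sup>2 * 4 powr q\<close> is the quotient of the upper by the
    lower coefficient in \<open>Vflux_elliptic\<close>. The power of Q + k cancels, so the ratio is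
    the same at every point.\<close>
  have 2: "\<exists>lam>0. \<forall>\<xi>. lam * (norm \<xi>)\<^sup>2 \<le> Vflux ((-1) ^ CARD('n)) \<rho> \<rho>' \<omega> x \<xi> \<bullet> \<xi> \<and>
      Vflux ((-1) ^ CARD('n)) \<rho> \<rho>' \<omega> x \<xi> \<bullet> \<xi> \<le> (2 * K\<^sup>2 * 4 powr q) * lam * (norm \<xi>)\<^sup>2"
    if "0 < k" for x
  proof (intro exI conjI allI)
    let ?lam = "rpow (?Q x + k) q / (4 * K * 4 powr q)"
    note E = Vflux_elliptic[of \<rho> \<rho>' K k q, OF D nonneg K k q lower upper]
    \<comment> \<open>A positive \<open>k\<close> keeps this base positive even at zeros of
      \<omega>, so the lower coefficient is strictly positive.\<close>
    have "0 < ?Q x + k" using that finner_self_nonneg[of "\<omega> x"] by linarith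
    then show "0 < ?lam" using K by (simp add: rpow_pos)
    fix \<xi> :: "(real,'n) vec"
    show "?lam * (norm \<xi>)\<^sup>2 \<le> Vflux ((-1) ^ CARD('n)) \<rho> \<rho>' \<omega> x \<xi> \<bullet> \<xi>"
      by (rule E(1))
    have "(2 * K\<^sup>2 * 4 powr q) * ?lam = K * rpow (?Q x + k) q / 2"
      using K by (simp add: power2_eq_square)
    then show "Vflux ((-1) ^ CARD('n)) \<rho> \<rho>' \<omega> x \<xi> \<bullet> \<xi> \<le> (2 * K\<^sup>2 * 4 powr q) * ?lam * (norm \<xi>)\<^sup>2"
      using E(2)[of \<omega> x \<xi>] by (simp only:)
  qed
  show "let Q = ?Q in
        (\<exists>C>0. \<forall>\<phi>::(real,'n) vec \<Rightarrow> real.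
            Cinf_on \<phi> UNIV \<and> (\<forall>x. \<phi> x \<ge> 0) \<and>
            (\<exists>S. compact S \<and> S \<subseteq> \<Omega> \<and> (\<forall>x. x \<notin> S \<longrightarrow> \<phi> x = 0))
            \<longrightarrow> (\<exists>J. ((\<lambda>x. - (Vflux ((-1) ^ CARD('n)) \<rho> \<rho>' \<omega> x (grad Q x) \<bullet> grad \<phi> x)
                           + C * rpow (Q x + k) q * (grad_norm u x + finner (u x) (u x))
                             * Q x * \<phi> x) has_integral J) \<Omega> \<and> J \<ge> 0))
        \<and> (k > 0 \<longrightarrow>
            (\<exists>\<Lambda>. \<forall>x\<in>\<Omega>. \<exists>lam>0. \<forall>\<xi>::(real,'n) vec.
               lam * norm \<xi> ^ 2 \<le> Vflux ((-1) ^ CARD('n)) \<rho> \<rho>' \<omega> x \<xi> \<bullet> \<xi> \<and>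
               Vflux ((-1) ^ CARD('n)) \<rho> \<rho>' \<omega> x \<xi> \<bullet> \<xi> \<le> \<Lambda> * lam * norm \<xi> ^ 2))"
    unfolding Let_def
    using C 1[unfolded M_def] 2 by blast
qed

end
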